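(* Consider admissible complex multilinear autonomous equations $\mathcal E(u_{0,0},u_{1,0},u_{0,1},u_{1,1})=0$ on the square lattice, and the notions of linearizability by a point transformation and of equivalence (Möbius transformation of the dependent variable, possibly composed with the exchange $n\leftrightarrow m$), all as defined in the context. (1) An admissible equation is linearizable by a point transformation $f$ that is a Möbius (fractional linear) function if and only if it is equivalent to an equation of the form $$w_{0,1}w_{1,1}(w_{1,0}+\beta w_{0,0})+w_{0,0}w_{1,0}(\gamma w_{1,1}+\delta w_{0,1})+\epsilon\, w_{0,0}w_{1,0}w_{0,1}w_{1,1}=0,$$ with $\epsilon\in\{0,1\}$ and $\beta,\gamma,\delta\in\mathbb C\setminus\{0\}$. The displayed equation is linearized by the inversion $\tilde u_{i,j}=1/w_{i,j}$: nonzero complex numbers $w_{0,0},w_{1,0},w_{0,1},w_{1,1}$ satisfy it if and only if $$\tilde u_{0,0}+\beta\tilde u_{1,0}+\gamma\tilde u_{0,1}+\delta\tilde u_{1,1}+\epsilon=0.$$ (2) An admissible equation is linearizable by a point transformation, but not by one that is a Möbius function, if and only if it is equivalent to one of the following six equations, where in (e) and (f) $\theta\in\mathbb C\setminus\{0\}$ is an arbitrary parameter: (a) $w_{0,0}w_{1,0}w_{0,1}w_{1,1}-1=0$, (b) $w_{0,0}-w_{1,0}w_{0,1}w_{1,1}=0$, (c) $w_{1,0}-w_{0,0}w_{0,1}w_{1,1}=0$, (d) $w_{1,1}-w_{0,0}w_{1,0}w_{0,1}=0$, (e) $w_{0,1}w_{1,1}-\theta w_{0,0}w_{1,0}=0$,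 (f) $w_{0,0}w_{1,1}-\theta w_{1,0}w_{0,1}=0$. These are linearized by $\tilde u_{i,j}=\log w_{i,j}$, where $\log$ is the principal branch of the complex logarithm: nonzero complex numbers $w_{0,0},w_{1,0},w_{0,1},w_{1,1}$ satisfy (a), ..., (f), respectively, if and only if there is an integer $z$ such that, respectively, (a) $\tilde u_{0,0}+\tilde u_{1,0}+\tilde u_{0,1}+\tilde u_{1,1}=2\pi \mathrm i z$, (b) $-\tilde u_{0,0}+\tilde u_{1,0}+\tilde u_{0,1}+\tilde u_{1,1}=2\pi \mathrm i z$, (c) $\tilde u_{0,0}-\tilde u_{1,0}+\tilde u_{0,1}+\tilde u_{1,1}=2\pi \mathrm i z$, (d) $-\tilde u_{0,0}-\tilde u_{1,0}-\tilde u_{0,1}+\tilde u_{1,1}=2\pi \mathrm i z$, (e) $-\tilde u_{0,0}-\tilde u_{1,0}+\tilde u_{0,1}+\tilde u_{1,1}=\log\theta+2\pi \mathrm i z$, (f) $\tilde u_{0,0}-\tilde u_{1,0}-\tilde u_{0,1}+\tilde u_{1,1}=\log\theta+2\pi \mathrm i z$.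
   Context: Lattice and notation. A complex field $u_{n,m}$, $(n,m)\in\mathbb Z^2$, satisfies an autonomous (coefficients independent of $n,m$) equation relating the four values on each elementary square, $\mathcal E(u_{n,m},u_{n+1,m},u_{n,m+1},u_{n+1,m+1})=0$. By translation invariance it is written at $n=m=0$ as $\mathcal E(u_{0,0},u_{1,0},u_{0,1},u_{1,1})=0$, where $u_{i,j}$ denotes the value at $(n+i,m+j)$. The four values are treated as complex variables related only by this one equation. Admissible multilinear equation. $\mathcal E\in\mathbb C[u_{0,0},u_{1,0},u_{0,1},u_{1,1}]$ is a polynomial of degree at most $1$ in each of the four variables separately (so it has 16 coefficients), such that $\mathcal E=0$ can be solved for each of the four variables as a rational function of the other three, and each of these four rational functions depends effectively on all of its three arguments (each of its three partial derivatives is not identically zero). In particular $u_{1,1}=F(u_{0,0},u_{1,0},u_{0,1})$ with $\partial F/\partial u_{0,0}$, $\partial F/\partial u_{1,0}$, $\partial F/\partial u_{0,1}$ not identically zero. Linearizable by a point transformation. The equation $\mathcal E=0$ is linearizable by the (autonomous) point transformation $\tilde u_{n,m}=f(u_{n,m})$ if $f$ is a complex differentiable function with $f'\neq 0$ on a nonempty connected open set $U\subset\mathbb C$ (the same $f$ at all four vertices), and there are constants $a,b,c,d\in\mathbb C\setminus\{0\}$ and $e\in\mathbb C$, such that $$a f(u_{0,0})+b f(u_{1,0})+c f(u_{0,1})+d f\big(F(u_{0,0},u_{1,0},u_{0,1})\big)+e=0$$ holds identically for all $(u_{0,0},u_{1,0},u_{0,1})$ in some nonempty open subset of $U^3$ on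 which $F$ is defined and takes values in $U$. That is, $\tilde u$ satisfies the linear autonomous equation $a\tilde u_{0,0}+b\tilde u_{1,0}+c\tilde u_{0,1}+d\tilde u_{1,1}+e=0$. The equation is linearizable by a Möbius function if $f$ can be taken of the form $f(x)=\frac{c_1x+c_2}{c_3x+c_4}$ with $c_1c_4-c_2c_3\neq0$. Equivalence. Two multilinear equations are equivalent if, up to a nonzero constant factor of the polynomial, one is obtained from the other by a Möbius transformation of the dependent variable, $u_{i,j}=\frac{b_1 w_{i,j}+b_2}{b_3 w_{i,j}+b_4}$ with $b_1b_4-b_2b_3\neq0$ (the same $b_k\in\mathbb C$ at all four vertices), followed by multiplication by $\prod_{i,j\in\{0,1\}}(b_3w_{i,j}+b_4)$ to clear denominators, possibly composed with the exchange of independent variables $n\leftrightarrow m$, i.e. the interchange of the variables with indices $(1,0)$ and $(0,1)$. *)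

theory Defs
  imports "HOL-Complex_Analysis.Complex_Analysis"
begin

text \<open>
  Polynomials over the complex numbers are identified with the functions they induce.
  A function of four arguments \<open>E x y z t\<close> stands for the polynomial in
  \<open>x = u\<^sub>0\<^sub>0\<close>, \<open>y = u\<^sub>1\<^sub>0\<close>, \<open>z = u\<^sub>0\<^sub>1\<close>, \<open>t = u\<^sub>1\<^sub>1\<close>, always in this order.
\<close>

type_synonym fun3 = "complex \<Rightarrow> complex \<Rightarrow> complex \<Rightarrow> complex"
type_synonym fun4 = "complex \<Rightarrow> complex \<Rightarrow> complex \<Rightarrow> complex \<Rightarrow> complex"

definition multilinear :: "fun4 \<Rightarrow> bool" where
  "multilinear E \<longleftrightarrow>
     (\<exists>c :: nat \<Rightarrow> nat \<Rightarrow> nat \<Rightarrow> nat \<Rightarrow> complex. \<forall>x y z t.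
        E x y z t = (\<Sum>i\<le>1. \<Sum>j\<le>1. \<Sum>k\<le>1. \<Sum>l\<le>1. c i j k l * x ^ i * y ^ j * z ^ k * t ^ l))"

definition polynomial3 :: "fun3 \<Rightarrow> bool" where
  "polynomial3 P \<longleftrightarrow>
     (\<exists>(N :: nat) (c :: nat \<Rightarrow> nat \<Rightarrow> nat \<Rightarrow> complex). \<forall>x y z.
        P x y z = (\<Sum>i\<le>N. \<Sum>j\<le>N. \<Sum>k\<le>N. c i j k * x ^ i * y ^ j * z ^ k))"

text \<open>
  The rational function \<open>P / Q\<close> solves \<open>E = 0\<close> for the last variable.
\<close>

definition solves_for_last :: "fun4 \<Rightarrow> fun3 \<Rightarrow> fun3 \<Rightarrow> bool" where
  "solves_for_last E P Q \<longleftrightarrow>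
     polynomial3 P \<and> polynomial3 Q \<and> (\<exists>x y z. Q x y z \<noteq> 0) \<and>
     (\<forall>x y z t. Q x y z \<noteq> 0 \<longrightarrow> (E x y z t = 0 \<longleftrightarrow> t = P x y z / Q x y z))"

definition depends_on_all :: "fun3 \<Rightarrow> fun3 \<Rightarrow> bool" where
  "depends_on_all P Q \<longleftrightarrow>
     (\<exists>x y z. Q x y z \<noteq> 0 \<and> deriv (\<lambda>x'. P x' y z / Q x' y z) x \<noteq> 0) \<and>
     (\<exists>x y z. Q x y z \<noteq> 0 \<and> deriv (\<lambda>y'. P x y' z / Q x y' z) y \<noteq> 0) \<and>
     (\<exists>x y z. Q x y z \<noteq> 0 \<and> deriv (\<lambda>z'. P x y z' / Q x y z') z \<noteq> 0)"

definition solvable_for_last :: "fun4 \<Rightarrow> bool" where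
  "solvable_for_last E \<longleftrightarrow> (\<exists>P Q. solves_for_last E P Q \<and> depends_on_all P Q)"

definition admissible :: "fun4 \<Rightarrow> bool" where
  "admissible E \<longleftrightarrow>
     multilinear E \<and>
     solvable_for_last (\<lambda>y z t x. E x y z t) \<and>
     solvable_for_last (\<lambda>x z t y. E x y z t) \<and>
     solvable_for_last (\<lambda>x y t z. E x y z t) \<and>
     solvable_for_last (\<lambda>x y z t. E x y z t)"

text \<open>
  \<open>P / Q\<close> below is the function \<open>F\<close> with \<open>u\<^sub>1\<^sub>1 = F(u\<^sub>0\<^sub>0, u\<^sub>1\<^sub>0, u\<^sub>0\<^sub>1)\<close>. As a rational function it is
  determined by \<open>E\<close>.
\<close>

definition linearizes :: "(complex \<Rightarrow> complex) \<Rightarrow> complex set \<Rightarrow> fun4 \<Rightarrow> bool" where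
  "linearizes f U E \<longleftrightarrow>
     open U \<and> connected U \<and> U \<noteq> {} \<and> f holomorphic_on U \<and> (\<forall>x\<in>U. deriv f x \<noteq> 0) \<and>
     (\<exists>P Q a b c d e W.
        solves_for_last E P Q \<and>
        a \<noteq> 0 \<and> b \<noteq> 0 \<and> c \<noteq> 0 \<and> d \<noteq> 0 \<and>
        open W \<and> W \<noteq> {} \<and> W \<subseteq> U \<times> U \<times> U \<and>
        (\<forall>(x, y, z)\<in>W. Q x y z \<noteq> 0 \<and> P x y z / Q x y z \<in> U \<and>
           a * f x + b * f y + c * f z + d * f (P x y z / Q x y z) + e = 0))"

definition point_linearizable :: "fun4 \<Rightarrow> bool" where
  "point_linearizable E \<longleftrightarrow> (\<exists>f U. linearizes f U E)"

definition moebius_linearizable :: "fun4 \<Rightarrow> bool" where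
  "moebius_linearizable E \<longleftrightarrow>
     (\<exists>f U c1 c2 c3 c4. linearizes f U E \<and> c1 * c4 - c2 * c3 \<noteq> 0 \<and>
        (\<forall>x\<in>U. c3 * x + c4 \<noteq> 0 \<and> f x = moebius c1 c2 c3 c4 x))"

text \<open>
  \<open>G\<close> arises from \<open>E\<close>. Both sides being polynomials in the variables \<open>w\<close> after clearing
  denominators, it suffices to compare them off the poles, where the substitution is not
  affected by division by zero.
\<close>

definition moebius_transformed :: "fun4 \<Rightarrow> fun4 \<Rightarrow> bool" where
  "moebius_transformed E G \<longleftrightarrow>
     (\<exists>k b1 b2 b3 b4. k \<noteq> 0 \<and> b1 * b4 - b2 * b3 \<noteq> 0 \<and>
        (\<forall>x y z t. b3 * x + b4 \<noteq> 0 \<and> b3 * y + b4 \<noteq> 0 \<and> b3 * z + b4 \<noteq> 0 \<and> b3 * t + b4 \<noteq> 0 \<longrightarrow>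
           G x y z t =
             k * ((b3 * x + b4) * (b3 * y + b4) * (b3 * z + b4) * (b3 * t + b4)) *
             E (moebius b1 b2 b3 b4 x) (moebius b1 b2 b3 b4 y)
               (moebius b1 b2 b3 b4 z) (moebius b1 b2 b3 b4 t)))"

definition exchange :: "fun4 \<Rightarrow> fun4" where
  "exchange E = (\<lambda>x y z t. E x z y t)"

definition obtained_from :: "fun4 \<Rightarrow> fun4 \<Rightarrow> bool" where
  "obtained_from G E \<longleftrightarrow> moebius_transformed E G \<or> moebius_transformed E (exchange G)"

definition equivalent :: "fun4 \<Rightarrow> fun4 \<Rightarrow> bool" where
  "equivalent E G \<longleftrightarrow>
     multilinear E \<and> multilinear G \<and> (obtained_from G E \<or> obtained_from E G)"

definition eq_inv :: "complex \<Rightarrow> complex \<Rightarrow> complex \<Rightarrow> complex \<Rightarrow> fun4" where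
  "eq_inv \<beta> \<gamma> \<delta> \<epsilon> = (\<lambda>w00 w10 w01 w11.
     w01 * w11 * (w10 + \<beta> * w00) + w00 * w10 * (\<gamma> * w11 + \<delta> * w01) + \<epsilon> * w00 * w10 * w01 * w11)"

definition eq_a :: fun4 where
  "eq_a = (\<lambda>w00 w10 w01 w11. w00 * w10 * w01 * w11 - 1)"

definition eq_b :: fun4 where
  "eq_b = (\<lambda>w00 w10 w01 w11. w00 - w10 * w01 * w11)"

definition eq_c :: fun4 where
  "eq_c = (\<lambda>w00 w10 w01 w11. w10 - w00 * w01 * w11)"

definition eq_d :: fun4 where
  "eq_d = (\<lambda>w00 w10 w01 w11. w11 - w00 * w10 * w01)"

definition eq_e :: "complex \<Rightarrow> fun4" where
  "eq_e \<theta> = (\<lambda>w00 w10 w01 w11. w01 * w11 - \<theta> * w00 * w10)"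

definition eq_f :: "complex \<Rightarrow> fun4" where
  "eq_f \<theta> = (\<lambda>w00 w10 w01 w11. w00 * w11 - \<theta> * w10 * w01)"

end

theory Submission
  imports Defs
begin

text \<open>
  Differentiating \<open>a f(x) + b f(y) + c f(z) + d f(F(x, y, z)) + e = 0\<close> in \<open>x\<close> and in \<open>y\<close> and
  eliminating \<open>f'(F)\<close> gives \<open>a f'(x) F\<^sub>y = b f'(y) F\<^sub>x\<close>. For a multilinear \<open>E\<close> the numerator of
  \<open>F\<^sub>y\<close> is \<open>E\<^sub>y E\<^sub>t - E E\<^sub>y\<^sub>t\<close>, which depends on \<open>x\<close> and \<open>z\<close> only and is quadratic in \<open>x\<close>, that of
  \<open>F\<^sub>x\<close> does not depend on \<open>x\<close>, and the denominators agree. Hence \<open>f'\<close> is a constant divided by a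
  quadratic polynomial \<open>q\<close>.

  If \<open>q\<close> has a double root on the sphere, then \<open>f\<close> is a Moebius function; in the coordinate \<open>f\<close> the
  equation vanishes on a hyperplane, so it is proportional to the linear one. Otherwise
  \<open>m f = log g + const\<close> for a Moebius function \<open>g\<close>. In the coordinate \<open>g\<close> the monomials of the
  equation, restricted to its solutions, become exponentials of linear forms; linear independence
  of distinct exponentials leaves only two complementary monomials, since the exponents of two
  monomials which can cancel differ by a multiple of \<open>(a, b, c, d)\<close>, all of whose entries are
  nonzero. Scaling the coordinate normalizes the coefficients of the resulting binomial.
\<close>

subsection \<open>Multilinear functions and Moebius transformations\<close>

text \<open>Degree at most one in one variable, with the coefficients hidden: multilinearity can
  then be proved by closure rules alone.\<close>

definition affine1 :: "(complex \<Rightarrow> complex) \<Rightarrow> bool" where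
  "affine1 g \<longleftrightarrow> (\<exists>p q. \<forall>x. g x = p + q * x)"

lemma affine1_intros:
  "affine1 (\<lambda>x. c)" "affine1 (\<lambda>x. x)"
  "affine1 g \<Longrightarrow> affine1 h \<Longrightarrow> affine1 (\<lambda>x. g x + h x)"
  "affine1 g \<Longrightarrow> affine1 h \<Longrightarrow> affine1 (\<lambda>x. g x - h x)"
  "affine1 g \<Longrightarrow> affine1 (\<lambda>x. c * g x)"
  "affine1 g \<Longrightarrow> affine1 (\<lambda>x. g x * c)"
proof -
  show "affine1 (\<lambda>x. c)" unfolding affine1_def by (rule exI[of _ c], rule exI[of _ 0]) simp
  show "affine1 (\<lambda>x. x)" unfolding affine1_def by (rule exI[of _ 0], rule exI[of _ 1]) simp
  show "affine1 (\<lambda>x. g x + h x)" if "affine1 g" "affine1 h"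
  proof -
    from that obtain p q p' q' where "\<And>x. g x = p + q * x" "\<And>x. h x = p' + q' * x"
      unfolding affine1_def by metis
    thus ?thesis unfolding affine1_def
      by (intro exI[of _ "p + p'"] exI[of _ "q + q'"]) (simp add: algebra_simps)
  qed
  show "affine1 (\<lambda>x. g x - h x)" if "affine1 g" "affine1 h"
  proof -
    from that obtain p q p' q' where "\<And>x. g x = p + q * x" "\<And>x. h x = p' + q' * x"
      unfolding affine1_def by metis
    thus ?thesis unfolding affine1_def
      by (intro exI[of _ "p - p'"] exI[of _ "q - q'"]) (simp add: algebra_simps)
  qed
  show *: "affine1 (\<lambda>x. c * g x)" if "affine1 g"
  proof -
    from that obtain p q where "\<And>x. g x = p + q * x"
      unfolding affine1_def by metis
    thus ?thesis unfolding affine1_def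
      by (intro exI[of _ "c * p"] exI[of _ "c * q"]) (simp add: algebra_simps)
  qed
  show "affine1 (\<lambda>x. g x * c)" if "affine1 g"
    using *[OF that] by (simp add: mult.commute)
qed

lemma affine1_power: "i \<le> 1 \<Longrightarrow> affine1 (\<lambda>x. x ^ i)"
  by (cases i) (auto intro: affine1_intros)

lemma affine1_sum: "(\<And>i. i \<in> I \<Longrightarrow> affine1 (f i)) \<Longrightarrow> affine1 (\<lambda>x. \<Sum>i\<in>I. f i x)"
  by (induction I rule: infinite_finite_induct) (auto intro: affine1_intros)

lemma affine1_eq: "affine1 g \<Longrightarrow> g x = g 0 + x * (g 1 - g 0)"
  by (auto simp: affine1_def)

lemma affine1_unique:
  assumes "affine1 g" "affine1 h" "g x1 = h x1" "g x2 = h x2" "x1 \<noteq> x2"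
  shows "g x = h x"
proof -
  from assms obtain p q p' q' where g: "\<And>x. g x = p + q * x" and h: "\<And>x. h x = p' + q' * x"
    unfolding affine1_def by metis
  have "(q - q') * (x1 - x2) = 0" using assms(3,4) unfolding g h by algebra
  hence "q = q'" using assms(5) by simp
  thus ?thesis using assms(3) unfolding g h by simp
qed

text \<open>Degree at most one in each variable separately already gives a joint expansion: the
  coefficients are iterated differences between the points 0 and 1, and these stay affine in the
  variables not yet treated.\<close>

lemma multilinear_iff:
  "multilinear E \<longleftrightarrow>
     (\<forall>y z t. affine1 (\<lambda>x. E x y z t)) \<and> (\<forall>x z t. affine1 (\<lambda>y. E x y z t)) \<and>
     (\<forall>x y t. affine1 (\<lambda>z. E x y z t)) \<and> (\<forall>x y z. affine1 (\<lambda>t. E x y z t))"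
    (is "_ \<longleftrightarrow> ?R")
proof
  assume "multilinear E"
  then obtain c :: "nat \<Rightarrow> nat \<Rightarrow> nat \<Rightarrow> nat \<Rightarrow> complex" where
    c: "\<And>x y z t. E x y z t =
      (\<Sum>i\<le>1. \<Sum>j\<le>1. \<Sum>k\<le>1. \<Sum>l\<le>1. c i j k l * x ^ i * y ^ j * z ^ k * t ^ l)"
    unfolding multilinear_def by blast
  show ?R unfolding c by (auto intro!: affine1_intros affine1_sum affine1_power)
next
  assume R: ?R
  define D where "D = (\<lambda>(g :: complex \<Rightarrow> complex) (i::nat). if i = 0 then g 0 else g 1 - g 0)"
  have D: "g x = (\<Sum>i\<le>1. D g i * x ^ i)" if "affine1 g" for g x
    using affine1_eq[OF that, of x] by (simp add: D_def)
  have D_affine: "affine1 (\<lambda>x. D (G x) i)" if "\<And>y. affine1 (\<lambda>x. G x y)" for G i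
    using that by (cases "i = 0") (auto simp: D_def intro!: affine1_intros)
  define c where "c = (\<lambda>i j k l. D (\<lambda>t. D (\<lambda>z. D (\<lambda>y. D (\<lambda>x. E x y z t) i) j) k) l)"
  have "E x y z t = (\<Sum>i\<le>1. \<Sum>j\<le>1. \<Sum>k\<le>1. \<Sum>l\<le>1. c i j k l * x ^ i * y ^ j * z ^ k * t ^ l)"
    for x y z t
  proof -
    have 1: "E x y z t = (\<Sum>i\<le>1. D (\<lambda>x. E x y z t) i * x ^ i)"
      using R by (intro D) blast
    have 2: "D (\<lambda>x. E x y z t) i = (\<Sum>j\<le>1. D (\<lambda>y. D (\<lambda>x. E x y z t) i) j * y ^ j)" for i
      using R by (intro D D_affine) blast
    have 3: "D (\<lambda>y. D (\<lambda>x. E x y z t) i) j =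
        (\<Sum>k\<le>1. D (\<lambda>z. D (\<lambda>y. D (\<lambda>x. E x y z t) i) j) k * z ^ k)" for i j
      using R by (intro D D_affine) blast
    have 4: "D (\<lambda>z. D (\<lambda>y. D (\<lambda>x. E x y z t) i) j) k = (\<Sum>l\<le>1. c i j k l * t ^ l)" for i j k
      unfolding c_def using R by (intro D D_affine) blast
    show ?thesis
      unfolding 1 2 3 4 sum_distrib_right by (intro sum.cong refl) (simp only: mult_ac)
  qed
  thus "multilinear E" unfolding multilinear_def by blast
qed

text \<open>Two points outside \<open>S\<close> determine an affine function, so the variables are
  freed from the restriction one after another. Identities known only off poles are extended in this
  way.\<close>

lemma multilinear_unique:
  assumes "multilinear E" "multilinear G" "finite S"
    and eq: "\<And>x y z t. x \<notin> S \<Longrightarrow> y \<notin> S \<Longrightarrow> z \<notin> S \<Longrightarrow> t \<notin> S \<Longrightarrow> E x y z t = G x y z t"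
  shows "E = G"
proof -
  obtain p where p: "p \<notin> S" using assms(3) infinite_UNIV_char_0 ex_new_if_finite by blast
  obtain q where q: "q \<notin> insert p S"
    using assms(3) infinite_UNIV_char_0 ex_new_if_finite by (metis finite_insert)
  hence q: "q \<notin> S" "p \<noteq> q" by auto
  have 1: "E x y z t = G x y z t" if "y \<notin> S" "z \<notin> S" "t \<notin> S" for x y z t
    using affine1_unique[of "\<lambda>x. E x y z t" "\<lambda>x. G x y z t" p q x] assms p q that
    by (simp add: multilinear_iff)
  have 2: "E x y z t = G x y z t" if "z \<notin> S" "t \<notin> S" for x y z t
    using affine1_unique[of "\<lambda>y. E x y z t" "\<lambda>y. G x y z t" p q y] assms p q that 1
    by (simp add: multilinear_iff)
  have 3: "E x y z t = G x y z t" if "t \<notin> S" for x y z t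
    using affine1_unique[of "\<lambda>z. E x y z t" "\<lambda>z. G x y z t" p q z] assms p q that 2
    by (simp add: multilinear_iff)
  have "E x y z t = G x y z t" for x y z t
    using affine1_unique[of "\<lambda>t. E x y z t" "\<lambda>t. G x y z t" p q t] assms p q 3
    by (simp add: multilinear_iff)
  thus ?thesis by blast
qed

section \<open>Inverses, existence and composition of Moebius transformations of multilinear
  functions\<close>

definition transformed_by ::
  "complex \<Rightarrow> complex \<Rightarrow> complex \<Rightarrow> complex \<Rightarrow> complex \<Rightarrow> fun4 \<Rightarrow> fun4 \<Rightarrow> bool" where
  "transformed_by k b1 b2 b3 b4 E G \<longleftrightarrow> k \<noteq> 0 \<and> b1 * b4 - b2 * b3 \<noteq> 0 \<and>
     (\<forall>x y z t. b3 * x + b4 \<noteq> 0 \<longrightarrow> b3 * y + b4 \<noteq> 0 \<longrightarrow> b3 * z + b4 \<noteq> 0 \<longrightarrow> b3 * t + b4 \<noteq> 0 \<longrightarrow>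
        G x y z t =
          k * ((b3 * x + b4) * (b3 * y + b4) * (b3 * z + b4) * (b3 * t + b4)) *
          E (moebius b1 b2 b3 b4 x) (moebius b1 b2 b3 b4 y)
            (moebius b1 b2 b3 b4 z) (moebius b1 b2 b3 b4 t))"

lemma moebius_transformed_iff:
  "moebius_transformed E G \<longleftrightarrow> (\<exists>k b1 b2 b3 b4. transformed_by k b1 b2 b3 b4 E G)"
  unfolding moebius_transformed_def transformed_by_def by (simp add: imp_conjL)

lemma transformed_byD:
  assumes "transformed_by k b1 b2 b3 b4 E G"
  shows "k \<noteq> 0" "b1 * b4 - b2 * b3 \<noteq> 0"
    "b3 * x + b4 \<noteq> 0 \<Longrightarrow> b3 * y + b4 \<noteq> 0 \<Longrightarrow> b3 * z + b4 \<noteq> 0 \<Longrightarrow> b3 * t + b4 \<noteq> 0 \<Longrightarrow>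
      G x y z t = k * ((b3 * x + b4) * (b3 * y + b4) * (b3 * z + b4) * (b3 * t + b4)) *
        E (moebius b1 b2 b3 b4 x) (moebius b1 b2 b3 b4 y)
          (moebius b1 b2 b3 b4 z) (moebius b1 b2 b3 b4 t)"
  using assms unfolding transformed_by_def by blast+

text \<open>\<open>moebius b4 (- b2) (- b3) b1\<close> comes from the adjugate matrix and so inverts
  \<open>moebius b1 b2 b3 b4\<close>. The denominators of a map and of its inverse at corresponding
  points multiply to the determinant, hence none of them vanishes.\<close>

lemma moebius_denominator:
  fixes b1 b2 b3 b4 u :: complex
  assumes "b1 * b4 - b2 * b3 \<noteq> 0" "- b3 * u + b1 \<noteq> 0"
  shows "b3 * moebius b4 (- b2) (- b3) b1 u + b4 = (b1 * b4 - b2 * b3) / (- b3 * u + b1)"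
    "b3 * moebius b4 (- b2) (- b3) b1 u + b4 \<noteq> 0"
    "moebius b1 b2 b3 b4 (moebius b4 (- b2) (- b3) b1 u) = u"
proof -
  show *: "b3 * moebius b4 (- b2) (- b3) b1 u + b4 = (b1 * b4 - b2 * b3) / (- b3 * u + b1)"
    using assms(2) unfolding moebius_def by (simp add: field_simps)
  show "b3 * moebius b4 (- b2) (- b3) b1 u + b4 \<noteq> 0" unfolding * using assms by simp
  show "moebius b1 b2 b3 b4 (moebius b4 (- b2) (- b3) b1 u) = u"
    using assms moebius_inverse[of b4 b1 "-b2" "-b3" u] by (simp add: algebra_simps)
qed

text \<open>The four pairs of denominators at corresponding points multiply to the fourth power of
  the determinant, which accounts for the new constant.\<close>

lemma transformed_by_sym:
  assumes "transformed_by k b1 b2 b3 b4 E G"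
  shows "transformed_by (1 / (k * (b1 * b4 - b2 * b3) ^ 4)) b4 (- b2) (- b3) b1 G E"
proof -
  note k = transformed_byD(1)[OF assms] and det = transformed_byD(2)[OF assms]
    and G = transformed_byD(3)[OF assms]
  define D where "D = b1 * b4 - b2 * b3"
  define g where "g = moebius b4 (-b2) (-b3) b1"
  have D0: "D \<noteq> 0" using det by (simp add: D_def)
  note den = moebius_denominator[OF det]
  have "E x y z t = 1 / (k * D ^ 4) *
        ((- b3 * x + b1) * (- b3 * y + b1) * (- b3 * z + b1) * (- b3 * t + b1)) *
        G (g x) (g y) (g z) (g t)"
    if a: "- b3 * x + b1 \<noteq> 0" "- b3 * y + b1 \<noteq> 0" "- b3 * z + b1 \<noteq> 0" "- b3 * t + b1 \<noteq> 0"
    for x y z t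
  proof -
    define X Y Z T where XYZT: "X = - b3 * x + b1" "Y = - b3 * y + b1" "Z = - b3 * z + b1" "T = - b3 * t + b1"
    have nz: "X \<noteq> 0" "Y \<noteq> 0" "Z \<noteq> 0" "T \<noteq> 0" using a by (auto simp: XYZT)
    have "G (g x) (g y) (g z) (g t) = k * (D / X * (D / Y) * (D / Z) * (D / T)) * E x y z t"
      unfolding g_def D_def XYZT
      by (rule G[OF den(2)[OF a(1)] den(2)[OF a(2)] den(2)[OF a(3)] den(2)[OF a(4)],
            unfolded den(1)[OF a(1)] den(1)[OF a(2)] den(1)[OF a(3)] den(1)[OF a(4)]
              den(3)[OF a(1)] den(3)[OF a(2)] den(3)[OF a(3)] den(3)[OF a(4)]])
    hence "E x y z t = 1 / (k * D ^ 4) * (X * Y * Z * T) * G (g x) (g y) (g z) (g t)"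
      using nz k D0 by (simp add: field_simps eval_nat_numeral)
    thus ?thesis unfolding XYZT .
  qed
  moreover have "1 / (k * D ^ 4) \<noteq> 0" "b4 * b1 - - b2 * - b3 \<noteq> 0"
    using k D0 by (auto simp: D_def algebra_simps)
  ultimately show ?thesis unfolding transformed_by_def D_def g_def by blast
qed

lemma moebius_transformed_sym: "moebius_transformed E G \<Longrightarrow> moebius_transformed G E"
  unfolding moebius_transformed_iff using transformed_by_sym by blast

lemma transform_exists:
  assumes "multilinear E" and det: "b1 * b4 - b2 * b3 \<noteq> 0"
  obtains G where "multilinear G" "transformed_by 1 b1 b2 b3 b4 E G"
proof -
  from assms obtain c :: "nat \<Rightarrow> nat \<Rightarrow> nat \<Rightarrow> nat \<Rightarrow> complex" where
    c: "\<And>x y z t. E x y z t =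
      (\<Sum>i\<le>1. \<Sum>j\<le>1. \<Sum>k\<le>1. \<Sum>l\<le>1. c i j k l * x ^ i * y ^ j * z ^ k * t ^ l)"
    unfolding multilinear_def by blast
  \<comment> \<open>\<open>m i\<close> is what \<open>x ^ i\<close> becomes after substitution and
    multiplication by one factor \<open>b3 * w + b4\<close>; it is affine in \<open>w\<close> for
    either exponent.\<close>
  define m where "m = (\<lambda>(i::nat) w. (b3 * w + b4) * of_bool (i = 0) + (b1 * w + b2) * of_bool (i \<noteq> 0))"
  define G where "G = (\<lambda>x y z t. \<Sum>i\<le>1. \<Sum>j\<le>1. \<Sum>k\<le>1. \<Sum>l\<le>1. c i j k l * m i x * m j y * m k z * m l t)"
  have "multilinear G" unfolding multilinear_iff G_def m_def
    by (auto intro!: affine1_sum affine1_intros)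
  moreover have "G x y z t = 1 * ((b3 * x + b4) * (b3 * y + b4) * (b3 * z + b4) * (b3 * t + b4)) *
             E (moebius b1 b2 b3 b4 x) (moebius b1 b2 b3 b4 y)
               (moebius b1 b2 b3 b4 z) (moebius b1 b2 b3 b4 t)"
    if "b3 * x + b4 \<noteq> 0" "b3 * y + b4 \<noteq> 0" "b3 * z + b4 \<noteq> 0" "b3 * t + b4 \<noteq> 0" for x y z t
  proof -
    have m: "m i w = (b3 * w + b4) * moebius b1 b2 b3 b4 w ^ i" if "b3 * w + b4 \<noteq> 0" "i \<le> 1" for i w
      using that by (cases i) (auto simp: m_def moebius_def)
    show ?thesis unfolding G_def c sum_distrib_left
      by (intro sum.cong refl) (simp add: m that)
  qed
  ultimately show thesis using that det unfolding transformed_by_def by simp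
qed

lemma finite_linear_roots:
  fixes p q :: complex
  assumes "p \<noteq> 0 \<or> q \<noteq> 0"
  shows "finite {w. p * w + q = 0}"
proof (cases "p = 0")
  case False
  hence "{w. p * w + q = 0} \<subseteq> {- q / p}" by (auto simp: field_simps eq_neg_iff_add_eq_0)
  thus ?thesis using finite_subset by blast
qed (use assms in simp)

text \<open>The coefficients of the composite form the matrix product. Substituting twice gives the
  formula only where neither the inner map nor the composite has a pole, while the definition asks
  for it at every point that is no pole of the composite.\<close>

lemma moebius_transformed_trans:
  assumes "multilinear E" "multilinear N" "moebius_transformed E G" "moebius_transformed G N"
  shows "moebius_transformed E N"
proof -
  from assms(3) obtain k b1 b2 b3 b4 where EG: "transformed_by k b1 b2 b3 b4 E G"
    unfolding moebius_transformed_iff by blast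
  from assms(4) obtain k' b1' b2' b3' b4' where GN: "transformed_by k' b1' b2' b3' b4' G N"
    unfolding moebius_transformed_iff by blast
  note k = transformed_byD(1)[OF EG] and det = transformed_byD(2)[OF EG] and G = transformed_byD(3)[OF EG]
  note k' = transformed_byD(1)[OF GN] and det' = transformed_byD(2)[OF GN] and N = transformed_byD(3)[OF GN]
  define B1 B2 B3 B4 where B: "B1 = b1 * b1' + b2 * b3'" "B2 = b1 * b2' + b2 * b4'"
    "B3 = b3 * b1' + b4 * b3'" "B4 = b3 * b2' + b4 * b4'"
  have "B1 * B4 - B2 * B3 = (b1 * b4 - b2 * b3) * (b1' * b4' - b2' * b3')"
    unfolding B by algebra
  hence Bdet: "B1 * B4 - B2 * B3 \<noteq> 0" using det det' by simp
  \<comment> \<open>Transforming \<open>E\<close> directly by the product matrix gives an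
    \<open>M\<close> with the formula at all required points; uniqueness off the finite set
    \<open>S\<close> identifies \<open>N\<close> as a multiple of \<open>M\<close>.\<close>
  obtain M where M: "multilinear M" and EM: "transformed_by 1 B1 B2 B3 B4 E M"
    using transform_exists[OF assms(1) Bdet] .
  note M_eq = transformed_byD(3)[OF EM]
  define S where "S = {w. b3' * w + b4' = 0} \<union> {w. B3 * w + B4 = 0}"
  have "finite S" unfolding S_def using det' Bdet by (auto intro!: finite_linear_roots)
  have *: "b3' * w + b4' \<noteq> 0 \<and> B3 * w + B4 \<noteq> 0 \<and>
      B3 * w + B4 = (b3' * w + b4') * (b3 * moebius b1' b2' b3' b4' w + b4) \<and>
      b3 * moebius b1' b2' b3' b4' w + b4 \<noteq> 0 \<and>
      moebius b1 b2 b3 b4 (moebius b1' b2' b3' b4' w) = moebius B1 B2 B3 B4 w" if "w \<notin> S" for w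
  proof -
    have n: "b3' * w + b4' \<noteq> 0" "B3 * w + B4 \<noteq> 0" using that by (auto simp: S_def)
    have e: "B3 * w + B4 = (b3' * w + b4') * (b3 * moebius b1' b2' b3' b4' w + b4)"
      using n(1) unfolding B moebius_def by (simp add: field_simps)
    have e': "B1 * w + B2 = (b3' * w + b4') * (b1 * moebius b1' b2' b3' b4' w + b2)"
      using n(1) unfolding B moebius_def by (simp add: field_simps)
    have "moebius B1 B2 B3 B4 w = moebius b1 b2 b3 b4 (moebius b1' b2' b3' b4' w)"
      using n(1) unfolding moebius_def[of B1] moebius_def[of b1] e e' by simp
    thus ?thesis using n e by auto
  qed
  have "N = (\<lambda>x y z t. k * k' * M x y z t)"
  proof (rule multilinear_unique[OF assms(2) _ \<open>finite S\<close>])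
    show "multilinear (\<lambda>x y z t. k * k' * M x y z t)"
      using M unfolding multilinear_iff by (auto intro: affine1_intros)
    fix x y z t assume S: "x \<notin> S" "y \<notin> S" "z \<notin> S" "t \<notin> S"
    note * = *[OF S(1)] *[OF S(2)] *[OF S(3)] *[OF S(4)]
    show "N x y z t = k * k' * M x y z t"
      using * by (simp add: N G M_eq)
  qed
  hence "transformed_by (k * k') B1 B2 B3 B4 E N"
    using k k' Bdet M_eq unfolding transformed_by_def by (simp add: mult.assoc)
  thus ?thesis unfolding moebius_transformed_iff by blast
qed

lemma moebius_transformed_exchange:
  assumes "moebius_transformed E G"
  shows "moebius_transformed (exchange E) (exchange G)"
proof -
  from assms obtain k b1 b2 b3 b4 where "transformed_by k b1 b2 b3 b4 E G"
    unfolding moebius_transformed_iff by blast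
  hence "transformed_by k b1 b2 b3 b4 (exchange E) (exchange G)"
    unfolding transformed_by_def exchange_def by (simp add: mult_ac)
  thus ?thesis unfolding moebius_transformed_iff by blast
qed

text \<open>Being a Moebius transform is a symmetric relation compatible with the exchange, so the
  two directions allowed in the definition collapse to one.\<close>

lemma equivalent_iff:
  "equivalent E G \<longleftrightarrow>
    multilinear E \<and> multilinear G \<and> (moebius_transformed E G \<or> moebius_transformed E (exchange G))"
proof -
  have [simp]: "exchange (exchange E) = E" for E by (simp add: exchange_def)
  have "moebius_transformed G E \<longleftrightarrow> moebius_transformed E G" for E G
    using moebius_transformed_sym by blast
  moreover have "moebius_transformed G (exchange E) \<longleftrightarrow> moebius_transformed E (exchange G)" for E G
    using moebius_transformed_sym moebius_transformed_exchange[of _ "exchange _"]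
    by (metis \<open>\<And>E. exchange (exchange E) = E\<close>)
  ultimately show ?thesis unfolding equivalent_def obtained_from_def by blast
qed

text \<open>\<open>G\<close> is \<open>E\<close> written in the coordinate
  \<open>moebius c1 c2 c3 c4\<close>: the inverse map carries \<open>E\<close> to \<open>G\<close>,
  and inverting once more expresses the values of \<open>E\<close> through those of
  \<open>G\<close>.\<close>

lemma pullback:
  assumes "multilinear E" "c1 * c4 - c2 * c3 \<noteq> 0"
  obtains G k where "multilinear G" "transformed_by k c1 c2 c3 c4 G E" "moebius_transformed E G"
proof -
  have "c4 * c1 - - c2 * - c3 \<noteq> 0" using assms(2) by (simp add: algebra_simps)
  from transform_exists[OF assms(1) this] obtain G where
    G: "multilinear G" "transformed_by 1 c4 (- c2) (- c3) c1 E G" .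
  have "\<exists>k. transformed_by k c1 (- (- c2)) (- (- c3)) c4 G E"
    using transformed_by_sym[OF G(2)] by blast
  hence "\<exists>k. transformed_by k c1 c2 c3 c4 G E" by (simp only: minus_minus)
  thus ?thesis using that G unfolding moebius_transformed_iff by blast
qed

subsection \<open>The derivative of a linearizing function\<close>

definition slope :: "fun4 \<Rightarrow> fun3" where
  "slope E x y z = E x y z 1 - E x y z 0"

text \<open>The rational function \<open>F\<close> obtained by solving \<open>E = 0\<close>, in the
  one representation used from here on.\<close>

definition sol :: "fun4 \<Rightarrow> fun3" where
  "sol E x y z = - E x y z 0 / slope E x y z"

lemma multilinear_affineD:
  assumes "multilinear E"
  shows "affine1 (\<lambda>x. E x y z t)" "affine1 (\<lambda>y. E x y z t)" "affine1 (\<lambda>z. E x y z t)"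
    "affine1 (\<lambda>t. E x y z t)"
  using assms unfolding multilinear_iff by auto

lemma multilinear_slope:
  assumes "multilinear E"
  shows "E x y z t = E x y z 0 + t * slope E x y z"
  unfolding slope_def using affine1_eq[OF multilinear_affineD(4)[OF assms]] .

lemma sol_eq_iff:
  assumes "multilinear E" "slope E x y z \<noteq> 0"
  shows "E x y z t = 0 \<longleftrightarrow> t = sol E x y z"
  using assms(2) unfolding multilinear_slope[OF assms(1), of x y z t] sol_def
  by (auto simp: field_simps eq_neg_iff_add_eq_0 add.commute)

text \<open>A vanishing slope would make \<open>E\<close> independent of \<open>t\<close>, so that a
  second value of \<open>t\<close> would solve the equation too. Hence all pairs \<open>P\<close>,
  \<open>Q\<close> give the same function where \<open>Q\<close> does not vanish.\<close>

lemma solves_for_last_sol: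
  assumes "multilinear E" "solves_for_last E P Q" "Q x y z \<noteq> 0"
  shows "slope E x y z \<noteq> 0 \<and> P x y z / Q x y z = sol E x y z"
proof -
  have iff: "E x y z t = 0 \<longleftrightarrow> t = P x y z / Q x y z" for t
    using assms(2,3) unfolding solves_for_last_def by blast
  have s: "slope E x y z \<noteq> 0"
  proof
    assume s: "slope E x y z = 0"
    hence "E x y z t = E x y z 0" for t
      using multilinear_slope[OF assms(1), of x y z t] by simp
    hence "E x y z (P x y z / Q x y z + 1) = 0" using iff by metis
    thus False using iff by simp
  qed
  show ?thesis using sol_eq_iff[OF assms(1) s] iff s by blast
qed

lemma solves_for_last_intro:
  assumes ml: "multilinear E" and nz: "slope E x y z \<noteq> 0"
  shows "solves_for_last E (\<lambda>x y z. - E x y z 0) (slope E)"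
proof -
  from ml obtain c :: "nat \<Rightarrow> nat \<Rightarrow> nat \<Rightarrow> nat \<Rightarrow> complex" where
    c: "\<And>x y z t. E x y z t =
      (\<Sum>i\<le>1. \<Sum>j\<le>1. \<Sum>k\<le>1. \<Sum>l\<le>1. c i j k l * x ^ i * y ^ j * z ^ k * t ^ l)"
    unfolding multilinear_def by blast
  have E0: "E x y z 0 = (\<Sum>i\<le>1. \<Sum>j\<le>1. \<Sum>k\<le>1. c i j k 0 * x ^ i * y ^ j * z ^ k)" for x y z
    unfolding c by simp
  have E1: "slope E x y z = (\<Sum>i\<le>1. \<Sum>j\<le>1. \<Sum>k\<le>1. c i j k 1 * x ^ i * y ^ j * z ^ k)" for x y z
    unfolding slope_def c sum_subtractf[symmetric] by (intro sum.cong refl) simp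
  have "polynomial3 (\<lambda>x y z. - E x y z 0)"
    unfolding polynomial3_def
    by (rule exI[of _ 1], rule exI[of _ "\<lambda>i j k. - c i j k 0"]) (simp add: E0 sum_negf)
  moreover have "polynomial3 (slope E)"
    unfolding polynomial3_def by (rule exI[of _ 1], rule exI[of _ "\<lambda>i j k. c i j k 1"]) (simp add: E1)
  ultimately show ?thesis
    using nz sol_eq_iff[OF ml] unfolding solves_for_last_def sol_def by blast
qed

lemma multilinear_continuous:
  assumes "multilinear E"
  shows "continuous_on S (\<lambda>(x, y, z). E x y z t)"
proof -
  from assms obtain c :: "nat \<Rightarrow> nat \<Rightarrow> nat \<Rightarrow> nat \<Rightarrow> complex" where
    c: "\<And>x y z t. E x y z t =
      (\<Sum>i\<le>1. \<Sum>j\<le>1. \<Sum>k\<le>1. \<Sum>l\<le>1. c i j k l * x ^ i * y ^ j * z ^ k * t ^ l)"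
    unfolding multilinear_def by blast
  show ?thesis unfolding c case_prod_unfold by (intro continuous_intros)
qed

section \<open>Local form of linearization and its derivative\<close>

text \<open>One solution at which the affine form vanishes suffices: by continuity the form stays
  below 1 in norm nearby, and there \<open>rigid\<close> forces it to be zero. The norm bound leaves
  room for logarithms, where \<open>E = 0\<close> fixes the form only up to multiples of
  \<open>2 * pi * \<i>\<close>.\<close>

lemma linearizes_intro:
  assumes ml: "multilinear E" and U: "open U" "connected U"
    and f: "f holomorphic_on U" "\<And>x. x \<in> U \<Longrightarrow> deriv f x \<noteq> 0"
    and pt: "x0 \<in> U" "y0 \<in> U" "z0 \<in> U" "t0 \<in> U" "E x0 y0 z0 t0 = 0" "E x0 y0 z0 t1 \<noteq> 0"
    and nz: "a \<noteq> 0" "b \<noteq> 0" "c \<noteq> 0" "d \<noteq> 0"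
    and base: "a * f x0 + b * f y0 + c * f z0 + d * f t0 + e = 0"
    and rigid: "\<And>x y z t. x \<in> U \<Longrightarrow> y \<in> U \<Longrightarrow> z \<in> U \<Longrightarrow> t \<in> U \<Longrightarrow> E x y z t = 0 \<Longrightarrow>
      norm (a * f x + b * f y + c * f z + d * f t + e) < 1 \<Longrightarrow>
      a * f x + b * f y + c * f z + d * f t + e = 0"
  shows "linearizes f U E"
proof -
  have s0: "slope E x0 y0 z0 \<noteq> 0"
    using pt(5,6) multilinear_slope[OF ml, of x0 y0 z0] by (metis mult_zero_right)
  have r0: "sol E x0 y0 z0 = t0" using sol_eq_iff[OF ml s0] pt(5) by simp
  define R where "R = (\<lambda>(x, y, z). sol E x y z)"
  define \<rho> where "\<rho> = (\<lambda>(x, y, z). a * f x + b * f y + c * f z + d * f (sol E x y z) + e)"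
  define W1 where "W1 = (U \<times> U \<times> U) \<inter> (\<lambda>(x, y, z). slope E x y z) -` (- {0})"
  define W2 where "W2 = W1 \<inter> R -` U"
  define W where "W = W2 \<inter> \<rho> -` ball 0 1"
  have cs: "continuous_on S (\<lambda>(x, y, z). slope E x y z)" for S
    using multilinear_continuous[OF ml] unfolding slope_def case_prod_unfold
    by (intro continuous_intros) auto
  have o1: "open W1"
    unfolding W1_def by (intro continuous_open_preimage cs open_Times U open_delete) auto
  have cR: "continuous_on W1 R"
    using multilinear_continuous[OF ml, of W1 0] cs[of W1]
    unfolding R_def sol_def case_prod_unfold
    by (intro continuous_intros) (auto simp: W1_def)
  have o2: "open W2"
    unfolding W2_def by (intro continuous_open_preimage cR o1 U)
  have cf: "continuous_on U f" using f(1) holomorphic_on_imp_continuous_on by blast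
  have cf': "continuous_on W2 (\<lambda>p. f (g p))" if "continuous_on W2 g" "g ` W2 \<subseteq> U" for g
    using continuous_on_compose2[OF cf that] .
  have "continuous_on W2 (\<lambda>p. f (R p))"
    using continuous_on_subset[OF cR] by (intro cf') (auto simp: W2_def)
  moreover have cfst: "continuous_on W2 (\<lambda>p. f (fst p))" and csnd: "continuous_on W2 (\<lambda>p. f (fst (snd p)))"
    and ctrd: "continuous_on W2 (\<lambda>p. f (snd (snd p)))"
    by (intro cf' continuous_intros; auto simp: W2_def W1_def)+
  ultimately have c\<rho>: "continuous_on W2 \<rho>"
    unfolding \<rho>_def R_def case_prod_unfold
    by (intro continuous_intros cfst csnd ctrd)
  have o: "open W" unfolding W_def by (intro continuous_open_preimage c\<rho> o2 open_ball)
  have "(x0, y0, z0) \<in> W"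
    using pt s0 r0 base by (auto simp: W_def W2_def W1_def R_def \<rho>_def)
  hence ne: "W \<noteq> {}" by blast
  have *: "slope E x y z \<noteq> 0 \<and> sol E x y z \<in> U \<and>
      a * f x + b * f y + c * f z + d * f (sol E x y z) + e = 0" if "(x, y, z) \<in> W" for x y z
  proof -
    have m: "x \<in> U" "y \<in> U" "z \<in> U" "slope E x y z \<noteq> 0" "sol E x y z \<in> U"
      "norm (a * f x + b * f y + c * f z + d * f (sol E x y z) + e) < 1"
      using that by (auto simp: W_def W2_def W1_def R_def \<rho>_def)
    thus ?thesis using rigid[OF m(1-3,5) _ m(6)] sol_eq_iff[OF ml m(4)] by blast
  qed
  have rel: "\<forall>(x, y, z)\<in>W. slope E x y z \<noteq> 0 \<and> - E x y z 0 / slope E x y z \<in> U \<and>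
      a * f x + b * f y + c * f z + d * f (- E x y z 0 / slope E x y z) + e = 0"
    using * unfolding sol_def by auto
  have sub: "W \<subseteq> U \<times> U \<times> U" by (auto simp: W_def W2_def W1_def)
  show ?thesis
    unfolding linearizes_def
  proof (intro conjI ballI)
    show "\<exists>P Q a b c d e W. solves_for_last E P Q \<and>
       a \<noteq> 0 \<and> b \<noteq> 0 \<and> c \<noteq> 0 \<and> d \<noteq> 0 \<and>
       open W \<and> W \<noteq> {} \<and> W \<subseteq> U \<times> U \<times> U \<and>
       (\<forall>(x, y, z)\<in>W. Q x y z \<noteq> 0 \<and> P x y z / Q x y z \<in> U \<and>
          a * f x + b * f y + c * f z + d * f (P x y z / Q x y z) + e = 0)"
      by (rule exI[of _ "\<lambda>x y z. - E x y z 0"], rule exI[of _ "slope E"], rule exI[of _ a], rule exI[of _ b],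
      rule exI[of _ c], rule exI[of _ d], rule exI[of _ e], rule exI[of _ W])
      (intro conjI solves_for_last_intro[OF ml s0] nz o ne sub rel)
  qed (use U f pt(1) in auto)
qed

text \<open>A box inside the open set of the definition lets each variable move while the others are
  fixed, as partial derivatives and one-variable arguments require.\<close>

lemma linearizes_box:
  assumes ml: "multilinear E" and "linearizes f U E"
  obtains a b c d e X Y Z where
    "a \<noteq> 0" "b \<noteq> 0" "c \<noteq> 0" "d \<noteq> 0" "open X" "open Y" "open Z" "X \<noteq> {}" "Y \<noteq> {}" "Z \<noteq> {}"
    "X \<subseteq> U" "Y \<subseteq> U" "Z \<subseteq> U"
    "\<And>x y z. x \<in> X \<Longrightarrow> y \<in> Y \<Longrightarrow> z \<in> Z \<Longrightarrow> slope E x y z \<noteq> 0 \<and> sol E x y z \<in> U \<and>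
       a * f x + b * f y + c * f z + d * f (sol E x y z) + e = 0"
proof -
  from assms(2) obtain P Q a b c d e W where nz: "a \<noteq> 0" "b \<noteq> 0" "c \<noteq> 0" "d \<noteq> 0"
    and PQ: "solves_for_last E P Q" and W: "open W" "W \<noteq> {}" "W \<subseteq> U \<times> U \<times> U"
    and rel: "\<forall>(x, y, z)\<in>W. Q x y z \<noteq> 0 \<and> P x y z / Q x y z \<in> U \<and>
           a * f x + b * f y + c * f z + d * f (P x y z / Q x y z) + e = 0"
    unfolding linearizes_def by blast
  from W(2) obtain x0 y0 z0 where p: "(x0, y0, z0) \<in> W" by auto
  obtain X V where X: "open X" "open V" "(x0, y0, z0) \<in> X \<times> V" "X \<times> V \<subseteq> W"
    using open_prod_elim[OF W(1) p] .
  from X(3) have "(y0, z0) \<in> V" by simp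
  then obtain Y Z where Y: "open Y" "open Z" "(y0, z0) \<in> Y \<times> Z" "Y \<times> Z \<subseteq> V"
    using open_prod_elim[OF X(2)] by metis
  have sub: "(x, y, z) \<in> W" if "x \<in> X" "y \<in> Y" "z \<in> Z" for x y z using that X Y by blast
  have in0: "x0 \<in> X" "y0 \<in> Y" "z0 \<in> Z" using X Y by auto
  have subU: "X \<subseteq> U" "Y \<subseteq> U" "Z \<subseteq> U" using sub in0 W(3) by blast+
  have "slope E x y z \<noteq> 0 \<and> sol E x y z \<in> U \<and>
       a * f x + b * f y + c * f z + d * f (sol E x y z) + e = 0"
    if "x \<in> X" "y \<in> Y" "z \<in> Z" for x y z
    using rel sub[OF that] solves_for_last_sol[OF ml PQ, of x y z] by auto
  thus ?thesis using that[OF nz X(1) Y(1,2) _ _ _ subU] in0 by blast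
qed

text \<open>For multilinear \<open>E\<close> this is \<open>E\<^sub>y E\<^sub>t - E E\<^sub>y\<^sub>t\<close>, whatever the values of \<open>y\<close> and \<open>t\<close>.\<close>

definition disc :: "fun4 \<Rightarrow> complex \<Rightarrow> complex \<Rightarrow> complex" where
  "disc E x z = E x 1 z 0 * E x 0 z 1 - E x 0 z 0 * E x 1 z 1"

text \<open>With \<open>p\<close> and \<open>q\<close> the values of \<open>E\<close> at
  \<open>t = 0\<close> and \<open>t = 1\<close>, the quotient is \<open>sol\<close>. Up to sign the
  numerator of the derivative is the Wronskian of two affine functions, a constant that can be read
  off at 0 and 1.\<close>

lemma affine1_ratio_deriv:
  assumes "affine1 p" "affine1 q" "q x - p x \<noteq> 0"
  shows "((\<lambda>x. - p x / (q x - p x)) has_field_derivative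
    - (p 1 * q 0 - p 0 * q 1) / (q x - p x)\<^sup>2) (at x)"
proof -
  from assms(1,2) obtain u v u' v' where p: "p = (\<lambda>x. u + v * x)" and q: "q = (\<lambda>x. u' + v' * x)"
    unfolding affine1_def fun_eq_iff by metis
  have "((\<lambda>x. - (u + v * x) / (u' + v' * x - (u + v * x))) has_field_derivative
    (- v * (u' + v' * x - (u + v * x)) - (- (u + v * x)) * (v' - v)) /
      ((u' + v' * x - (u + v * x)) * (u' + v' * x - (u + v * x)))) (at x)"
    using assms(3) unfolding p q by (auto intro!: derivative_eq_intros)
  moreover have "- v * (u' + v' * x - (u + v * x)) - (- (u + v * x)) * (v' - v) =
      - ((u + v * 1) * (u' + v' * 0) - (u + v * 0) * (u' + v' * 1))"
    by algebra
  ultimately show ?thesis unfolding p q power2_eq_square by simp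
qed

text \<open>The second formula is the first one after exchanging \<open>x\<close> and
  \<open>y\<close>, so its numerator is free of \<open>x\<close>.\<close>

lemma sol_deriv:
  assumes "multilinear E" "slope E x y z \<noteq> 0"
  shows "((\<lambda>y. sol E x y z) has_field_derivative - disc E x z / (slope E x y z)\<^sup>2) (at y)"
    and "((\<lambda>x. sol E x y z) has_field_derivative
      - disc (\<lambda>x y z t. E y x z t) y z / (slope E x y z)\<^sup>2) (at x)"
  using affine1_ratio_deriv[of "\<lambda>y. E x y z 0" "\<lambda>y. E x y z 1" y]
    affine1_ratio_deriv[of "\<lambda>x. E x y z 0" "\<lambda>x. E x y z 1" x]
    multilinear_affineD[OF assms(1)] assms(2)
  by (simp_all add: sol_def slope_def disc_def)

lemma disc_quadratic:
  assumes ml: "multilinear E"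
  shows "\<exists>q0 q1 q2. \<forall>x. disc E x z = q0 + q1 * x + q2 * x\<^sup>2"
proof -
  define p where "p = (\<lambda>y t (i::nat). if i = 0 then E 0 y z t else E 1 y z t - E 0 y z t)"
  have p: "E x y z t = p y t 0 + p y t 1 * x" for x y t
    using affine1_eq[OF multilinear_affineD(1)[OF ml], of x y z t] by (simp add: p_def)
  show ?thesis
    by (rule exI[of _ "p 1 0 0 * p 0 1 0 - p 0 0 0 * p 1 1 0"],
        rule exI[of _ "p 1 0 0 * p 0 1 1 + p 1 0 1 * p 0 1 0 - p 0 0 0 * p 1 1 1 - p 0 0 1 * p 1 1 0"],
        rule exI[of _ "p 1 0 1 * p 0 1 1 - p 0 0 1 * p 1 1 1"])
      (simp add: disc_def p power2_eq_square algebra_simps)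
qed

text \<open>The relations obtained by differentiating in \<open>x\<close> and in \<open>y\<close>
  share the derivative of \<open>f\<close> at the solution and the squared slope. Eliminating both
  leaves \<open>deriv f x * disc E x z\<close> on one side and a term free of \<open>x\<close> on
  the other.\<close>

lemma linearizes_derivative:
  assumes ml: "multilinear E" and lin: "linearizes f U E"
  obtains Z where "open Z" "Z \<noteq> {}"
    "\<And>z. z \<in> Z \<Longrightarrow> \<exists>C. C \<noteq> 0 \<and> (\<forall>x\<in>U. deriv f x * disc E x z = C)"
proof -
  obtain a b c d e X Y Z where nz: "a \<noteq> 0" "b \<noteq> 0" "c \<noteq> 0" "d \<noteq> 0"
    and op: "open X" "open Y" "open Z" and ne: "X \<noteq> {}" "Y \<noteq> {}" "Z \<noteq> {}"
    and sub: "X \<subseteq> U" "Y \<subseteq> U" "Z \<subseteq> U"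
    and rel: "\<And>x y z. x \<in> X \<Longrightarrow> y \<in> Y \<Longrightarrow> z \<in> Z \<Longrightarrow> slope E x y z \<noteq> 0 \<and> sol E x y z \<in> U \<and>
       a * f x + b * f y + c * f z + d * f (sol E x y z) + e = 0"
    using linearizes_box[OF assms] by metis
  have U: "open U" "connected U" "f holomorphic_on U" "\<And>x. x \<in> U \<Longrightarrow> deriv f x \<noteq> 0"
    using lin unfolding linearizes_def by auto
  have df: "(f has_field_derivative deriv f x) (at x)" if "x \<in> U" for x
    using holomorphic_derivI[OF U(3,1) that] .
  obtain y0 where y0: "y0 \<in> Y" using ne by blast
  have "\<exists>C. C \<noteq> 0 \<and> (\<forall>x\<in>U. deriv f x * disc E x z = C)" if z: "z \<in> Z" for z
  proof -
    define D where "D = disc (\<lambda>x y z t. E y x z t)"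
    define C where "C = b * deriv f y0 * D y0 z / a"
    have main: "deriv f x * disc E x z = C \<and> C \<noteq> 0" if x: "x \<in> X" for x
    proof -
      note r = rel[OF x y0 z]
      define s where "s = slope E x y0 z"
      have s: "s \<noteq> 0" using r by (simp add: s_def)
      define \<phi> where "\<phi> = deriv f (sol E x y0 z)"
      have "((\<lambda>x. a * f x + b * f y0 + c * f z + d * f (sol E x y0 z) + e)
          has_field_derivative (a * deriv f x + d * (\<phi> * (- D y0 z / s\<^sup>2)))) (at x)"
        unfolding D_def s_def \<phi>_def
        using r x sub by (auto intro!: derivative_eq_intros df
           DERIV_chain2[OF df sol_deriv(2)[OF ml]])
      moreover have "((\<lambda>x. a * f x + b * f y0 + c * f z + d * f (sol E x y0 z) + e)
          has_field_derivative 0) (at x)"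
        by (rule has_field_derivative_transform_within_open[OF DERIV_const op(1) x])
          (use rel y0 z in auto)
      ultimately have "a * deriv f x + d * (\<phi> * (- D y0 z / s\<^sup>2)) = 0"
        using DERIV_unique by blast
      hence 1: "a * deriv f x * s\<^sup>2 = d * \<phi> * D y0 z" using s by (simp add: field_simps)
      have "((\<lambda>y. a * f x + b * f y + c * f z + d * f (sol E x y z) + e)
          has_field_derivative (b * deriv f y0 + d * (\<phi> * (- disc E x z / s\<^sup>2)))) (at y0)"
        unfolding s_def \<phi>_def
        using r y0 sub by (auto intro!: derivative_eq_intros df
           DERIV_chain2[OF df sol_deriv(1)[OF ml]])
      moreover have "((\<lambda>y. a * f x + b * f y + c * f z + d * f (sol E x y z) + e)
          has_field_derivative 0) (at y0)"
        by (rule has_field_derivative_transform_within_open[OF DERIV_const op(2) y0])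
          (use rel x z in auto)
      ultimately have "b * deriv f y0 + d * (\<phi> * (- disc E x z / s\<^sup>2)) = 0"
        using DERIV_unique by blast
      hence 2: "b * deriv f y0 * s\<^sup>2 = d * \<phi> * disc E x z" using s by (simp add: field_simps)
      have n: "deriv f x \<noteq> 0" "deriv f y0 \<noteq> 0" "\<phi> \<noteq> 0"
        using U(4) x y0 sub r by (auto simp: \<phi>_def)
      have D0: "D y0 z \<noteq> 0" using 1 n nz s by auto
      have "(d * \<phi>) * (a * deriv f x * disc E x z) = (d * \<phi>) * (b * deriv f y0 * D y0 z)"
        using 1 2 by algebra
      hence "a * deriv f x * disc E x z = b * deriv f y0 * D y0 z" using n nz by simp
      thus ?thesis using nz n D0 by (auto simp: C_def field_simps)
    qed
    obtain q0 q1 q2 where "\<forall>x. disc E x z = q0 + q1 * x + q2 * x\<^sup>2"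
      using disc_quadratic[OF ml, of z] by blast
    hence "(\<lambda>x. disc E x z) = (\<lambda>x. q0 + q1 * x + q2 * x\<^sup>2)" by (simp add: fun_eq_iff)
    moreover have "(\<lambda>x. q0 + q1 * x + q2 * x\<^sup>2) holomorphic_on U" by (intro holomorphic_intros)
    ultimately have "(\<lambda>x. disc E x z) holomorphic_on U" by (simp only:)
    hence hol: "(\<lambda>x. deriv f x * disc E x z) holomorphic_on U"
      by (intro holomorphic_on_mult holomorphic_deriv U(1,3))
    \<comment> \<open>So far \<open>x\<close> ranges over \<open>X\<close> only; the identity
      theorem on the connected set \<open>U\<close> extends the equation.\<close>
    have "deriv f x * disc E x z = C" if "x \<in> U" for x
      by (rule analytic_continuation_open[OF op(1) U(1) ne(1) U(2) sub(1) hol holomorphic_on_const _ that])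
        (use main in blast)
    moreover have "C \<noteq> 0" using main ne by blast
    ultimately show ?thesis by blast
  qed
  thus ?thesis using that op ne by blast
qed

subsection \<open>Linearization by Moebius functions\<close>

definition lin :: "complex \<Rightarrow> complex \<Rightarrow> complex \<Rightarrow> complex \<Rightarrow> complex \<Rightarrow> fun4" where
  "lin a b c d e = (\<lambda>x y z t. a * x + b * y + c * z + d * t + e)"

lemma multilinear_lin: "multilinear (lin a b c d e)"
  unfolding multilinear_iff lin_def by (intro conjI allI affine1_intros)

lemma multilinear_eq_inv: "multilinear (eq_inv \<beta> \<gamma> \<delta> \<epsilon>)"
  unfolding multilinear_iff eq_inv_def by (intro conjI allI affine1_intros)

lemma quadratic_zero:
  fixes q0 q1 q2 :: complex
  assumes "infinite S" "\<And>x. x \<in> S \<Longrightarrow> q0 + q1 * x + q2 * x\<^sup>2 = 0"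
  shows "q0 = 0 \<and> q1 = 0 \<and> q2 = 0"
proof -
  have "S \<subseteq> {x. poly [:q0, q1, q2:] x = 0}"
    using assms(2) by (auto simp: algebra_simps power2_eq_square)
  hence "[:q0, q1, q2:] = 0"
    using assms(1) poly_roots_finite finite_subset by blast
  thus ?thesis by simp
qed

lemma affine1_product_zero:
  assumes "affine1 g" "affine1 h" "affine1 l" "infinite S" "\<And>x. x \<in> S \<Longrightarrow> g x + h x * l x = 0"
  shows "g x + h x * l x = 0"
proof -
  obtain u v where g: "\<And>x. g x = u + v * x" using assms(1) unfolding affine1_def by blast
  obtain u' v' where h: "\<And>x. h x = u' + v' * x" using assms(2) unfolding affine1_def by blast
  obtain u'' v'' where l: "\<And>x. l x = u'' + v'' * x" using assms(3) unfolding affine1_def by blast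
  have e: "g x + h x * l x = (u + u' * u'') + (v + u' * v'' + v' * u'') * x + (v' * v'') * x\<^sup>2" for x
    unfolding g h l power2_eq_square by algebra
  show ?thesis
    using quadratic_zero[OF assms(4), of "u + u' * u''" "v + u' * v'' + v' * u''" "v' * v''"] assms(5)
    unfolding e by simp
qed

text \<open>The leading coefficient of the product is \<open>v\<close> times that of
  \<open>s\<close>, and it has to vanish for the product to be affine.\<close>

lemma affine1_product_const:
  assumes "affine1 s" "\<And>x. p x = (u + v * x) * s x" "affine1 p" "v \<noteq> 0"
  shows "s x = s 0"
proof -
  obtain m n where s: "\<And>x. s x = m + n * x" using assms(1) unfolding affine1_def by blast
  obtain m' n' where p: "\<And>x. p x = m' + n' * x" using assms(3) unfolding affine1_def by blast
  have "(u * m - m') + (u * n + v * m - n') * x + (v * n) * x\<^sup>2 = 0" for x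
    using assms(2)[of x] unfolding s p power2_eq_square by algebra
  hence "v * n = 0" using quadratic_zero[of UNIV] infinite_UNIV_char_0 by blast
  thus ?thesis using assms(4) s by simp
qed

lemma moebius_deriv:
  fixes c1 c2 c3 c4 x :: complex
  assumes "c3 * x + c4 \<noteq> 0"
  shows "(moebius c1 c2 c3 c4 has_field_derivative (c1 * c4 - c2 * c3) / (c3 * x + c4)\<^sup>2) (at x)"
proof -
  have "((\<lambda>x. (c1 * x + c2) / (c3 * x + c4)) has_field_derivative
    (c1 * (c3 * x + c4) - (c1 * x + c2) * c3) / ((c3 * x + c4) * (c3 * x + c4))) (at x)"
    using assms by (auto intro!: derivative_eq_intros)
  moreover have "c1 * (c3 * x + c4) - (c1 * x + c2) * c3 = c1 * c4 - c2 * c3" by algebra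
  ultimately show ?thesis unfolding moebius_def power2_eq_square by simp
qed

lemma moebius_inj:
  fixes c1 c2 c3 c4 :: complex
  assumes "c1 * c4 - c2 * c3 \<noteq> 0"
  shows "inj_on (moebius c1 c2 c3 c4) {x. c3 * x + c4 \<noteq> 0}"
proof (rule inj_on_inverseI)
  fix x assume "x \<in> {x. c3 * x + c4 \<noteq> 0}"
  thus "moebius c4 (- c2) (- c3) c1 (moebius c1 c2 c3 c4 x) = x"
    using moebius_inverse[of c1 c4 c2 c3 x] assms by simp
qed

text \<open>Substituting the hyperplane for \<open>t\<close> gives a polynomial of degree at most
  two in each variable, so it vanishes identically. Thus \<open>- G x y z 0\<close> is
  \<open>L\<close> times the slope. As \<open>L\<close> is nonconstant in each variable and the
  product is affine, the slope is constant, and \<open>G\<close> is this constant times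
  \<open>t - L\<close>.\<close>

lemma multilinear_vanishing_on_hyperplane:
  assumes ml: "multilinear G" and nz: "a \<noteq> 0" "b \<noteq> 0" "c \<noteq> 0" "d \<noteq> 0"
    and inf: "infinite X" "infinite Y" "infinite Z"
    and van: "\<And>x y z. x \<in> X \<Longrightarrow> y \<in> Y \<Longrightarrow> z \<in> Z \<Longrightarrow> G x y z (- (a * x + b * y + c * z + e) / d) = 0"
  shows "\<exists>k. G = lin (k * a) (k * b) (k * c) (k * d) (k * e)"
proof -
  note aff = multilinear_affineD[OF ml]
  define L where "L = (\<lambda>x y z. - (a * x + b * y + c * z + e) / d)"
  have L: "L x y z = (- (b * y + c * z + e) / d) + (- a / d) * x"
    "L x y z = (- (a * x + c * z + e) / d) + (- b / d) * y"
    "L x y z = (- (a * x + b * y + e) / d) + (- c / d) * z" for x y z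
    unfolding L_def using nz(4) by (simp_all add: field_simps)
  have aL: "affine1 (\<lambda>x. L x y z)" "affine1 (\<lambda>y. L x y z)" "affine1 (\<lambda>z. L x y z)" for x y z
    using L(1)[of _ y z] L(2)[of x _ z] L(3)[of x y] unfolding affine1_def by blast+
  have as: "affine1 (\<lambda>x. slope G x y z)" "affine1 (\<lambda>y. slope G x y z)" "affine1 (\<lambda>z. slope G x y z)" for x y z
    unfolding slope_def by (intro affine1_intros aff)+
  have 0: "G x y z 0 + L x y z * slope G x y z = 0" if "x \<in> X" "y \<in> Y" "z \<in> Z" for x y z
    using van[OF that] multilinear_slope[OF ml, of x y z "L x y z"] unfolding L_def by simp
  have 1: "G x y z 0 + L x y z * slope G x y z = 0" if "y \<in> Y" "z \<in> Z" for x y z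
    by (rule affine1_product_zero[OF aff(1) aL(1) as(1) inf(1) 0]) (use that in auto)
  have 2: "G x y z 0 + L x y z * slope G x y z = 0" if "z \<in> Z" for x y z
    by (rule affine1_product_zero[OF aff(2) aL(2) as(2) inf(2) 1]) (use that in auto)
  have 3: "G x y z 0 + L x y z * slope G x y z = 0" for x y z
    by (rule affine1_product_zero[OF aff(3) aL(3) as(3) inf(3) 2])
  have neg: "- G x y z 0 = L x y z * slope G x y z" for x y z
    using 3[of x y z] by (simp add: neg_eq_iff_add_eq_0)
  have aneg: "affine1 (\<lambda>x. - G x y z 0)" "affine1 (\<lambda>y. - G x y z 0)" "affine1 (\<lambda>z. - G x y z 0)" for x y z
    using affine1_intros(5)[OF aff(1)[of y z 0], of "- 1"] affine1_intros(5)[OF aff(2)[of x z 0], of "- 1"]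
      affine1_intros(5)[OF aff(3)[of x y 0], of "- 1"] by simp_all
  have nd: "- a / d \<noteq> 0" "- b / d \<noteq> 0" "- c / d \<noteq> 0" using nz by auto
  note neg' = neg[unfolded L(1)] neg[unfolded L(2)] neg[unfolded L(3)]
  have "slope G x y z = slope G 0 y z" for x y z
    using affine1_product_const[OF as(1) neg'(1)[of _ y z] aneg(1) nd(1)] .
  moreover have "slope G x y z = slope G x 0 z" for x y z
    using affine1_product_const[OF as(2) neg'(2)[of x _ z] aneg(2) nd(2)] .
  moreover have "slope G x y z = slope G x y 0" for x y z
    using affine1_product_const[OF as(3) neg'(3)[of x y] aneg(3) nd(3)] .
  ultimately have s: "slope G x y z = slope G 0 0 0" for x y z by metis
  define k where "k = slope G 0 0 0 / d"
  have "G x y z t = (t - L x y z) * slope G x y z" for x y z t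
    using multilinear_slope[OF ml, of x y z t] 3[of x y z] by algebra
  hence "G x y z t = (t - L x y z) * (k * d)" for x y z t
    by (simp add: s[of x y z] k_def nz(4))
  moreover have "(t - L x y z) * (k * d) = lin (k * a) (k * b) (k * c) (k * d) (k * e) x y z t" for x y z t
    using nz(4) by (simp add: lin_def L_def field_simps)
  ultimately have "G = lin (k * a) (k * b) (k * c) (k * d) (k * e)" by (simp add: fun_eq_iff)
  thus ?thesis by blast
qed

lemma open_nonempty_infinite: "open X \<Longrightarrow> X \<noteq> {} \<Longrightarrow> infinite (X :: complex set)"
  using finite_imp_not_open by blast

lemma slope_nonzero_not_zero: "slope E x y z \<noteq> 0 \<Longrightarrow> E \<noteq> (\<lambda>x y z t. 0)"
  by (auto simp: slope_def)

lemma transformed_by_zero: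
  assumes "multilinear E" "transformed_by k c1 c2 c3 c4 (\<lambda>x y z t. 0) E"
  shows "E = (\<lambda>x y z t. 0)"
proof (rule multilinear_unique[OF assms(1)])
  show "multilinear (\<lambda>x y z t. 0)" unfolding multilinear_iff by (intro conjI allI affine1_intros)
  show "finite {x. c3 * x + c4 = 0}"
    by (rule finite_linear_roots) (use transformed_byD(2)[OF assms(2)] in auto)
qed (use transformed_byD(3)[OF assms(2)] in simp)

section \<open>Moebius linearization and the linear equation\<close>

text \<open>In the coordinate \<open>f\<close> the equation holds on the part of a hyperplane that
  lies over a product of infinite sets, and this determines it up to a factor.\<close>

lemma moebius_linearizable_imp_lin:
  assumes ml: "multilinear E" and "moebius_linearizable E"
  shows "\<exists>a b c d e. a \<noteq> 0 \<and> b \<noteq> 0 \<and> c \<noteq> 0 \<and> d \<noteq> 0 \<and> moebius_transformed E (lin a b c d e)"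
proof -
  from assms(2) obtain f U c1 c2 c3 c4 where lin: "linearizes f U E" and det: "c1 * c4 - c2 * c3 \<noteq> 0"
    and f: "\<And>x. x \<in> U \<Longrightarrow> c3 * x + c4 \<noteq> 0 \<and> f x = moebius c1 c2 c3 c4 x"
    unfolding moebius_linearizable_def by blast
  obtain a b c d e X Y Z where nz: "a \<noteq> 0" "b \<noteq> 0" "c \<noteq> 0" "d \<noteq> 0"
    and op: "open X" "open Y" "open Z" and ne: "X \<noteq> {}" "Y \<noteq> {}" "Z \<noteq> {}"
    and sub: "X \<subseteq> U" "Y \<subseteq> U" "Z \<subseteq> U"
    and rel: "\<And>x y z. x \<in> X \<Longrightarrow> y \<in> Y \<Longrightarrow> z \<in> Z \<Longrightarrow> slope E x y z \<noteq> 0 \<and> sol E x y z \<in> U \<and>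
       a * f x + b * f y + c * f z + d * f (sol E x y z) + e = 0"
    using linearizes_box[OF ml lin] by metis
  obtain G k where G: "multilinear G" and GE: "transformed_by k c1 c2 c3 c4 G E"
    and EG: "moebius_transformed E G"
    using pullback[OF ml det] .
  have "inj_on f U"
    using moebius_inj[OF det] f unfolding inj_on_def by auto
  hence inf: "infinite (f ` V)" if "open V" "V \<noteq> {}" "V \<subseteq> U" for V
    using open_nonempty_infinite[OF that(1,2)] that(3) finite_image_iff inj_on_subset by blast
  have van: "G u v w (- (a * u + b * v + c * w + e) / d) = 0"
    if uvw: "u \<in> f ` X" "v \<in> f ` Y" "w \<in> f ` Z" for u v w
  proof -
    obtain x y z where p: "x \<in> X" "y \<in> Y" "z \<in> Z" and u: "u = f x" "v = f y" "w = f z"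
      using uvw by blast
    define t where "t = sol E x y z"
    note r = rel[OF p]
    have mem: "x \<in> U" "y \<in> U" "z \<in> U" "t \<in> U" using p sub r by (auto simp: t_def)
    have "E x y z t = 0" using sol_eq_iff[OF ml, of x y z t] r by (simp add: t_def)
    moreover have "E x y z t = k * ((c3 * x + c4) * (c3 * y + c4) * (c3 * z + c4) * (c3 * t + c4)) *
        G (f x) (f y) (f z) (f t)"
      using transformed_byD(3)[OF GE, of x y z t] f mem by simp
    ultimately have "G (f x) (f y) (f z) (f t) = 0"
      using f mem transformed_byD(1)[OF GE] by simp
    moreover have "f t = - (a * f x + b * f y + c * f z + e) / d"
      using r nz(4) unfolding t_def by (simp add: field_simps eq_neg_iff_add_eq_0 add_ac)
    ultimately show ?thesis unfolding u by simp
  qed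
  obtain m where m: "G = lin (m * a) (m * b) (m * c) (m * d) (m * e)"
    using multilinear_vanishing_on_hyperplane[OF G nz inf[OF op(1) ne(1) sub(1)]
      inf[OF op(2) ne(2) sub(2)] inf[OF op(3) ne(3) sub(3)] van] by blast
  \<comment> \<open>A zero factor would make \<open>E\<close> vanish identically, against its
    nonzero slope.\<close>
  have "m \<noteq> 0"
  proof
    assume "m = 0"
    hence "G = (\<lambda>x y z t. 0)" using m by (simp add: lin_def)
    hence "E = (\<lambda>x y z t. 0)" using transformed_by_zero[OF ml] GE by blast
    thus False using rel ne slope_nonzero_not_zero by blast
  qed
  thus ?thesis using EG nz unfolding m
    by (intro exI[of _ "m * a"] exI[of _ "m * b"] exI[of _ "m * c"] exI[of _ "m * d"] exI[of _ "m * e"]) auto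
qed

text \<open>Two coordinates are frozen at \<open>r\<close>; on the remaining line \<open>t\<close>
  is an injective function of \<open>x\<close>, so only finitely many points are excluded. This
  supplies base points away from poles.\<close>

lemma finite_hyperplane_avoid:
  fixes S :: "complex set"
  assumes "finite S" "a \<noteq> 0" "d \<noteq> 0"
  obtains x y z t where "x \<notin> S" "y \<notin> S" "z \<notin> S" "t \<notin> S" "lin a b c d e x y z t = 0"
proof -
  obtain r where r: "r \<notin> S" using assms(1) infinite_UNIV_char_0 ex_new_if_finite by blast
  define g where "g = (\<lambda>x. - (a * x + b * r + c * r + e) / d)"
  have "inj g" using assms(2,3) by (auto simp: inj_def g_def)
  hence "finite (S \<union> g -` S)" using assms(1) by (auto intro: finite_vimageI)
  then obtain x where x: "x \<notin> S \<union> g -` S" using infinite_UNIV_char_0 ex_new_if_finite by blast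
  have "lin a b c d e x r r (g x) = 0" using assms(3) by (simp add: lin_def g_def field_simps)
  thus ?thesis using that[of x r r "g x"] x r by auto
qed

lemma lin_imp_moebius_linearizable:
  assumes ml: "multilinear E" and nz: "a \<noteq> 0" "b \<noteq> 0" "c \<noteq> 0" "d \<noteq> 0"
    and tr: "moebius_transformed E (lin a b c d e)"
  shows "moebius_linearizable E"
proof -
  from moebius_transformed_sym[OF tr] obtain k c1 c2 c3 c4
    where GE: "transformed_by k c1 c2 c3 c4 (lin a b c d e) E"
    unfolding moebius_transformed_iff by blast
  note k = transformed_byD(1)[OF GE] and det = transformed_byD(2)[OF GE] and E = transformed_byD(3)[OF GE]
  define U where "U = UNIV - {x. c3 * x + c4 = 0}"
  define f where "f = moebius c1 c2 c3 c4"
  define h where "h = moebius c4 (- c2) (- c3) c1"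
  have fin: "finite {x. c3 * x + c4 = 0}"
    by (rule finite_linear_roots) (use det in auto)
  have oU: "open U" unfolding U_def using fin by (intro open_Diff finite_imp_closed) auto
  have cU: "connected U" unfolding U_def using fin by (intro connected_open_delete_finite) auto
  have Uiff: "x \<in> U \<longleftrightarrow> c3 * x + c4 \<noteq> 0" for x by (simp add: U_def)
  have df: "(f has_field_derivative (c1 * c4 - c2 * c3) / (c3 * x + c4)\<^sup>2) (at x)" if "x \<in> U" for x
    using moebius_deriv that unfolding f_def Uiff by blast
  have hol: "f holomorphic_on U"
    using df oU by (auto simp: holomorphic_on_open)
  have dn: "deriv f x \<noteq> 0" if "x \<in> U" for x
    using DERIV_imp_deriv[OF df[OF that]] det that by (simp add: Uiff)
  have Ezero: "E x y z t = 0 \<longleftrightarrow> a * f x + b * f y + c * f z + d * f t + e = 0"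
    if "x \<in> U" "y \<in> U" "z \<in> U" "t \<in> U" for x y z t
    using E[of x y z t] that k unfolding Uiff f_def lin_def by simp
  have "finite {v. - c3 * v + c1 = 0}" by (rule finite_linear_roots) (use det in auto)
  \<comment> \<open>A solution of the linear equation all of whose coordinates are values of
    \<open>f\<close>.\<close>
  from finite_hyperplane_avoid[OF this nz(1,4), of b c e]
  obtain v1 v2 v3 v4 where v: "- c3 * v1 + c1 \<noteq> 0" "- c3 * v2 + c1 \<noteq> 0" "- c3 * v3 + c1 \<noteq> 0"
    "- c3 * v4 + c1 \<noteq> 0" "lin a b c d e v1 v2 v3 v4 = 0"
    unfolding mem_Collect_eq by metis
  have hU: "h v \<in> U" "f (h v) = v" if "- c3 * v + c1 \<noteq> 0" for v
    using moebius_denominator(2,3)[OF det that] unfolding h_def f_def Uiff by auto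
  have "infinite U" using open_nonempty_infinite[OF oU] hU v by blast
  hence "U - {h v4} \<noteq> {}" by (metis infinite_remove finite.emptyI)
  then obtain t1 where t1: "t1 \<in> U" "t1 \<noteq> h v4" by blast
  have injf: "inj_on f U"
    using moebius_inj[OF det] unfolding f_def by (rule inj_on_subset) (auto simp: Uiff)
  have "f t1 \<noteq> f (h v4)"
    using inj_on_contraD[OF injf t1(2,1) hU(1)[OF v(4)]] .
  hence "f t1 \<noteq> v4" using hU(2)[OF v(4)] by simp
  moreover have "a * v1 + b * v2 + c * v3 + d * f t1 + e = d * (f t1 - v4)"
    using v(5) unfolding lin_def by algebra
  ultimately have n1: "E (h v1) (h v2) (h v3) t1 \<noteq> 0"
    using Ezero[OF hU(1)[OF v(1)] hU(1)[OF v(2)] hU(1)[OF v(3)] t1(1)] hU(2)[OF v(1)] hU(2)[OF v(2)]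
      hU(2)[OF v(3)] nz(4) by simp
  have base: "a * f (h v1) + b * f (h v2) + c * f (h v3) + d * f (h v4) + e = 0"
    using v hU by (simp add: lin_def)
  have "linearizes f U E"
  proof (rule linearizes_intro[OF ml oU cU hol dn hU(1)[OF v(1)] hU(1)[OF v(2)] hU(1)[OF v(3)]
        hU(1)[OF v(4)] _ n1 nz base])
    show "E (h v1) (h v2) (h v3) (h v4) = 0" 
      using base Ezero[OF hU(1)[OF v(1)] hU(1)[OF v(2)] hU(1)[OF v(3)] hU(1)[OF v(4)]] by simp
  qed (use Ezero in blast)+
  thus ?thesis unfolding moebius_linearizable_def using det
    by (intro exI[of _ f] exI[of _ U] exI[of _ c1] exI[of _ c2] exI[of _ c3] exI[of _ c4])
      (simp add: Uiff f_def)
qed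

text \<open>The substitution \<open>u = \<kappa> / w\<close> turns each linear term into a product
  of the three other variables; after division by \<open>a * \<kappa>\<close> the scale
  \<open>\<kappa>\<close> affects only the constant term.\<close>

lemma lin_eq_inv:
  assumes "a \<noteq> 0" "\<kappa> \<noteq> 0"
  shows "moebius_transformed (lin a b c d e) (eq_inv (b / a) (c / a) (d / a) (e / (a * \<kappa>)))"
proof -
  have "transformed_by (1 / (a * \<kappa>)) 0 \<kappa> 1 0 (lin a b c d e) (eq_inv (b / a) (c / a) (d / a) (e / (a * \<kappa>)))"
    using assms unfolding transformed_by_def by (simp add: lin_def eq_inv_def moebius_def field_simps)
  thus ?thesis unfolding moebius_transformed_iff by blast
qed

lemma moebius_linearizable_iff:
  assumes ml: "multilinear E"
  shows "moebius_linearizable E \<longleftrightarrow>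
    (\<exists>\<beta> \<gamma> \<delta> \<epsilon>. \<epsilon> \<in> {0, 1} \<and> \<beta> \<noteq> 0 \<and> \<gamma> \<noteq> 0 \<and> \<delta> \<noteq> 0 \<and> equivalent E (eq_inv \<beta> \<gamma> \<delta> \<epsilon>))"
proof
  assume "moebius_linearizable E"
  then obtain a b c d e where nz: "a \<noteq> 0" "b \<noteq> 0" "c \<noteq> 0" "d \<noteq> 0"
    and tr: "moebius_transformed E (lin a b c d e)"
    using moebius_linearizable_imp_lin[OF ml] by blast
  \<comment> \<open>This scale normalizes the constant term to 1 unless it is absent.\<close>
  define \<kappa> where "\<kappa> = (if e = 0 then 1 else e / a)"
  have \<kappa>: "\<kappa> \<noteq> 0" "e / (a * \<kappa>) \<in> {0, 1}" using nz by (auto simp: \<kappa>_def)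
  have "moebius_transformed E (eq_inv (b / a) (c / a) (d / a) (e / (a * \<kappa>)))"
    using moebius_transformed_trans[OF ml multilinear_eq_inv tr lin_eq_inv[OF nz(1) \<kappa>(1)]] .
  hence "equivalent E (eq_inv (b / a) (c / a) (d / a) (e / (a * \<kappa>)))"
    using ml multilinear_eq_inv unfolding equivalent_iff by blast
  thus "\<exists>\<beta> \<gamma> \<delta> \<epsilon>. \<epsilon> \<in> {0, 1} \<and> \<beta> \<noteq> 0 \<and> \<gamma> \<noteq> 0 \<and> \<delta> \<noteq> 0 \<and> equivalent E (eq_inv \<beta> \<gamma> \<delta> \<epsilon>)"
    using nz \<kappa> by (metis divide_eq_0_iff)
next
  assume "\<exists>\<beta> \<gamma> \<delta> \<epsilon>. \<epsilon> \<in> {0, 1} \<and> \<beta> \<noteq> 0 \<and> \<gamma> \<noteq> 0 \<and> \<delta> \<noteq> 0 \<and> equivalent E (eq_inv \<beta> \<gamma> \<delta> \<epsilon>)"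
  then obtain \<beta> \<gamma> \<delta> \<epsilon> where nz: "\<beta> \<noteq> 0" "\<gamma> \<noteq> 0" "\<delta> \<noteq> 0"
    and eq: "equivalent E (eq_inv \<beta> \<gamma> \<delta> \<epsilon>)" by blast
  \<comment> \<open>The exchange swaps \<open>\<beta>\<close> and \<open>\<gamma>\<close>, so it
    stays within the family.\<close>
  have "exchange (eq_inv \<beta> \<gamma> \<delta> \<epsilon>) = eq_inv \<gamma> \<beta> \<delta> \<epsilon>"
    by (auto simp: exchange_def eq_inv_def fun_eq_iff algebra_simps)
  with eq nz obtain \<beta>' \<gamma>' where nz': "\<beta>' \<noteq> 0" "\<gamma>' \<noteq> 0"
    and tr: "moebius_transformed E (eq_inv \<beta>' \<gamma>' \<delta> \<epsilon>)"
    unfolding equivalent_iff by metis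
  have "moebius_transformed (eq_inv \<beta>' \<gamma>' \<delta> \<epsilon>) (lin 1 \<beta>' \<gamma>' \<delta> \<epsilon>)"
    using lin_eq_inv[of 1 1 \<beta>' \<gamma>' \<delta> \<epsilon>] moebius_transformed_sym by simp
  from moebius_transformed_trans[OF ml multilinear_lin tr this]
  show "moebius_linearizable E"
    by (rule lin_imp_moebius_linearizable[OF ml one_neq_zero nz' nz(3)])
qed

subsection \<open>Linearization by logarithms\<close>

definition bin :: "complex \<Rightarrow> complex \<Rightarrow> nat \<Rightarrow> nat \<Rightarrow> nat \<Rightarrow> fun4" where
  "bin p p' i j k = (\<lambda>x y z t. p * x ^ i * y ^ j * z ^ k * t + p' * x ^ (1 - i) * y ^ (1 - j) * z ^ (1 - k))"

lemma multilinear_bin: "i \<le> 1 \<Longrightarrow> j \<le> 1 \<Longrightarrow> k \<le> 1 \<Longrightarrow> multilinear (bin p p' i j k)"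
  unfolding multilinear_iff bin_def by (intro conjI allI affine1_intros affine1_power) simp_all

text \<open>
  Applying the commuting operators \<open>D - \<mu>\<close> with \<open>D = (1/f') d/dx\<close> kills all but one of the
  eigenspaces.
\<close>

lemma exponentials_independent:
  fixes f f' :: "complex \<Rightarrow> complex" and C \<alpha> :: "'a \<Rightarrow> complex"
  assumes I: "finite I" and X: "open X" "X \<noteq> {}"
    and f: "\<And>x. x \<in> X \<Longrightarrow> (f has_field_derivative f' x) (at x)" "\<And>x. x \<in> X \<Longrightarrow> f' x \<noteq> 0"
    and zero: "\<And>x. x \<in> X \<Longrightarrow> (\<Sum>v\<in>I. C v * exp (\<alpha> v * f x)) = 0"
  shows "(\<Sum>v\<in>{v\<in>I. \<alpha> v = \<mu>}. C v) = 0"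
proof -
  \<comment> \<open>\<open>M\<close> collects the eigenvalues already killed; each of them leaves a
    factor \<open>\<alpha> v - m\<close> in the coefficients.\<close>
  have step: "\<forall>x\<in>X. (\<Sum>v\<in>I. C v * (\<Prod>m\<in>M. \<alpha> v - m) * exp (\<alpha> v * f x)) = 0" if "finite M" for M
    using that
  proof (induction M rule: finite_induct)
    case empty
    thus ?case using zero by simp
  next
    case (insert m M)
    define D where "D = (\<lambda>v. C v * (\<Prod>m\<in>M. \<alpha> v - m))"
    have IH: "(\<Sum>v\<in>I. D v * exp (\<alpha> v * f x)) = 0" if "x \<in> X" for x
      using insert.IH that by (simp add: D_def)
    have "(\<Sum>v\<in>I. D v * (\<alpha> v - m) * exp (\<alpha> v * f x)) = 0" if x: "x \<in> X" for x
    proof -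
      have "((\<lambda>x. \<Sum>v\<in>I. D v * exp (\<alpha> v * f x)) has_field_derivative
          (\<Sum>v\<in>I. D v * (exp (\<alpha> v * f x) * (\<alpha> v * f' x)))) (at x)"
        by (rule DERIV_sum) (auto intro!: derivative_eq_intros f(1)[OF x])
      moreover have "((\<lambda>x. \<Sum>v\<in>I. D v * exp (\<alpha> v * f x)) has_field_derivative 0) (at x)"
        by (rule has_field_derivative_transform_within_open[OF DERIV_const X(1) x]) (use IH in simp)
      ultimately have "(\<Sum>v\<in>I. D v * (exp (\<alpha> v * f x) * (\<alpha> v * f' x))) = 0"
        using DERIV_unique by blast
      moreover have "(\<Sum>v\<in>I. D v * (exp (\<alpha> v * f x) * (\<alpha> v * f' x))) =
          f' x * (\<Sum>v\<in>I. D v * \<alpha> v * exp (\<alpha> v * f x))"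
        unfolding sum_distrib_left by (intro sum.cong refl) (simp add: mult_ac)
      ultimately have "(\<Sum>v\<in>I. D v * \<alpha> v * exp (\<alpha> v * f x)) = 0" using f(2)[OF x] by simp
      moreover have "(\<Sum>v\<in>I. D v * (\<alpha> v - m) * exp (\<alpha> v * f x)) =
          (\<Sum>v\<in>I. D v * \<alpha> v * exp (\<alpha> v * f x)) - m * (\<Sum>v\<in>I. D v * exp (\<alpha> v * f x))"
        unfolding sum_distrib_left sum_subtractf[symmetric]
        by (intro sum.cong refl) (simp add: algebra_simps)
      ultimately show ?thesis using IH[OF x] by simp
    qed
    thus ?case using insert.hyps by (simp add: D_def mult_ac)
  qed
  \<comment> \<open>With all occurring exponents except \<open>\<mu>\<close> killed, the common
    factor \<open>P\<close> of the surviving terms is nonzero.\<close>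
  define M where "M = \<alpha> ` I - {\<mu>}"
  obtain x where x: "x \<in> X" using X(2) by blast
  define P where "P = (\<Prod>m\<in>M. \<mu> - m)"
  have "0 = (\<Sum>v\<in>I. C v * (\<Prod>m\<in>M. \<alpha> v - m) * exp (\<alpha> v * f x))"
    using step[of M] I x by (simp add: M_def)
  also have "\<dots> = (\<Sum>v\<in>{v\<in>I. \<alpha> v = \<mu>}. C v * (\<Prod>m\<in>M. \<alpha> v - m) * exp (\<alpha> v * f x))"
  proof (rule sum.mono_neutral_right)
    show "\<forall>v\<in>I - {v \<in> I. \<alpha> v = \<mu>}. C v * (\<Prod>m\<in>M. \<alpha> v - m) * exp (\<alpha> v * f x) = 0"
    proof
      fix v assume "v \<in> I - {v \<in> I. \<alpha> v = \<mu>}"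
      hence "\<alpha> v \<in> M" by (auto simp: M_def)
      hence "(\<Prod>m\<in>M. \<alpha> v - m) = 0" using I by (intro prod_zero) (auto simp: M_def)
      thus "C v * (\<Prod>m\<in>M. \<alpha> v - m) * exp (\<alpha> v * f x) = 0" by simp
    qed
  qed (use I in auto)
  also have "\<dots> = P * exp (\<mu> * f x) * (\<Sum>v\<in>{v\<in>I. \<alpha> v = \<mu>}. C v)"
    unfolding sum_distrib_left P_def by (intro sum.cong refl) auto
  finally show ?thesis using I by (auto simp: P_def M_def)
qed

text \<open>On the solutions each monomial is an exponential in \<open>\<phi> x\<close>,
  \<open>\<phi> y\<close> and \<open>\<phi> z\<close>, so the weights of monomials with the same
  three exponents sum to zero. A monomial therefore needs a partner, which can only be the
  complementary one. Such a pair fixes \<open>A\<close>, \<open>B\<close>, \<open>C\<close>, and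
  these in turn determine the pair, so there is just one.\<close>

lemma multilinear_vanishing_imp_bin:
  fixes \<phi> \<phi>' :: "complex \<Rightarrow> complex"
  assumes ml: "multilinear G" and G0: "G \<noteq> (\<lambda>x y z t. 0)"
    and nz: "A \<noteq> 0" "B \<noteq> 0" "C \<noteq> 0"
    and op: "open X" "open Y" "open Z" and ne: "X \<noteq> {}" "Y \<noteq> {}" "Z \<noteq> {}"
    and \<phi>: "\<And>x. x \<in> X \<union> Y \<union> Z \<Longrightarrow> (\<phi> has_field_derivative \<phi>' x) (at x)"
      "\<And>x. x \<in> X \<union> Y \<union> Z \<Longrightarrow> \<phi>' x \<noteq> 0"
    and van: "\<And>x y z. x \<in> X \<Longrightarrow> y \<in> Y \<Longrightarrow> z \<in> Z \<Longrightarrow>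
      G (exp (\<phi> x)) (exp (\<phi> y)) (exp (\<phi> z)) (exp (\<tau> - A * \<phi> x - B * \<phi> y - C * \<phi> z)) = 0"
  shows "\<exists>p p' i j k. p \<noteq> 0 \<and> p' \<noteq> 0 \<and> i \<le> 1 \<and> j \<le> 1 \<and> k \<le> 1 \<and> G = bin p p' i j k"
proof -
  from ml obtain c :: "nat \<Rightarrow> nat \<Rightarrow> nat \<Rightarrow> nat \<Rightarrow> complex" where
    c: "\<And>x y z t. G x y z t =
      (\<Sum>i\<le>1. \<Sum>j\<le>1. \<Sum>k\<le>1. \<Sum>l\<le>1. c i j k l * x ^ i * y ^ j * z ^ k * t ^ l)"
    unfolding multilinear_def by blast
  define I :: "(nat \<times> nat \<times> nat \<times> nat) set" where "I = {..1} \<times> {..1} \<times> {..1} \<times> {..1}"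
  define q where "q = (\<lambda>(i, j, k, l). c i j k l)"
  \<comment> \<open>Exponents of the monomial \<open>(i, j, k, l)\<close> once \<open>t\<close> is
    replaced by its value on the solutions, which enters all three of them through \<open>l\<close>;
    the constant \<open>\<tau>\<close> goes into the weight \<open>w\<close>.\<close>
  define \<alpha> where "\<alpha> = (\<lambda>(i :: nat, j :: nat, k :: nat, l :: nat). of_nat i - A * of_nat l)"
  define \<beta> where "\<beta> = (\<lambda>(i :: nat, j :: nat, k :: nat, l :: nat). of_nat j - B * of_nat l)"
  define \<gamma> where "\<gamma> = (\<lambda>(i :: nat, j :: nat, k :: nat, l :: nat). of_nat k - C * of_nat l)"
  define w where "w = (\<lambda>v. q v * exp (of_nat (snd (snd (snd v))) * \<tau>))"
  have fin: "finite I" by (simp add: I_def)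
  have G: "G x y z t = (\<Sum>(i, j, k, l)\<in>I. c i j k l * x ^ i * y ^ j * z ^ k * t ^ l)" for x y z t
    unfolding c I_def by (simp only: sum.cartesian_product)
  have mono: "c i j k l * exp r ^ i * exp s ^ j * exp u ^ k * exp (\<tau> - A * r - B * s - C * u) ^ l =
      w (i, j, k, l) * exp (\<gamma> (i, j, k, l) * u) * exp (\<beta> (i, j, k, l) * s) * exp (\<alpha> (i, j, k, l) * r)"
    for i j k l r s u
    unfolding w_def q_def \<alpha>_def \<beta>_def \<gamma>_def
    by (simp add: exp_of_nat_mult[symmetric] mult_exp_exp mult.assoc) (simp add: algebra_simps)
  have 0: "(\<Sum>v\<in>I. (w v * exp (\<gamma> v * \<phi> z) * exp (\<beta> v * \<phi> y)) * exp (\<alpha> v * \<phi> x)) = 0"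
    if "x \<in> X" "y \<in> Y" "z \<in> Z" for x y z
    using van[OF that] unfolding G mono by (simp add: case_prod_unfold)
  have 1: "(\<Sum>v\<in>{v\<in>I. \<alpha> v = \<mu>}. (w v * exp (\<gamma> v * \<phi> z)) * exp (\<beta> v * \<phi> y)) = 0"
    if "y \<in> Y" "z \<in> Z" for y z \<mu>
    by (rule exponentials_independent[OF fin op(1) ne(1), of \<phi> \<phi>']) (use \<phi> 0 that in auto)
  have 2: "(\<Sum>v\<in>{v\<in>I. \<alpha> v = \<mu> \<and> \<beta> v = \<nu>}. w v * exp (\<gamma> v * \<phi> z)) = 0" if "z \<in> Z" for z \<mu> \<nu>
    using exponentials_independent[of "{v\<in>I. \<alpha> v = \<mu>}", OF _ op(2) ne(2), of \<phi> \<phi>'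
       "\<lambda>v. w v * exp (\<gamma> v * \<phi> z)" \<beta> \<nu>] \<phi> 1 that fin by (simp add: conj_assoc)
  have 3: "(\<Sum>v\<in>{v\<in>I. \<alpha> v = \<mu> \<and> \<beta> v = \<nu> \<and> \<gamma> v = \<rho>}. w v) = 0" for \<mu> \<nu> \<rho>
    using exponentials_independent[of "{v\<in>I. \<alpha> v = \<mu> \<and> \<beta> v = \<nu>}", OF _ op(3) ne(3), of \<phi> \<phi>' w \<gamma> \<rho>]
      \<phi> 2 fin by (simp add: conj_assoc)
  have key: "c (1 - i) (1 - j) (1 - k) (1 - l) \<noteq> 0 \<and> A * (2 * of_nat l - 1) = 2 * of_nat i - 1 \<and>
      B * (2 * of_nat l - 1) = 2 * of_nat j - 1 \<and> C * (2 * of_nat l - 1) = 2 * of_nat k - 1"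
    if v0: "c i j k l \<noteq> 0" and le: "i \<le> 1" "j \<le> 1" "k \<le> 1" "l \<le> 1" for i j k l
  proof -
    define v where "v = (i, j, k, l)"
    define V where "V = {u\<in>I. \<alpha> u = \<alpha> v \<and> \<beta> u = \<beta> v \<and> \<gamma> u = \<gamma> v}"
    have vV: "v \<in> V" using le by (simp add: V_def I_def v_def)
    \<comment> \<open>The class of monomials with the exponents of \<open>v\<close> has total weight
      zero, so \<open>v\<close> is not alone in it.\<close>
    have "\<exists>u\<in>V. u \<noteq> v \<and> w u \<noteq> 0"
    proof (rule ccontr)
      assume "\<not> ?thesis"
      hence "(\<Sum>u\<in>V. w u) = (\<Sum>u\<in>{v}. w u)"
        using vV fin by (intro sum.mono_neutral_right) (auto simp: V_def)
      hence "w v = 0" using 3 by (simp add: V_def)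
      thus False using v0 by (simp add: w_def v_def q_def)
    qed
    then obtain i' j' k' l' where u: "(i', j', k', l') \<in> V" "(i', j', k', l') \<noteq> v" "w (i', j', k', l') \<noteq> 0"
      by auto
    have le': "i' \<le> 1" "j' \<le> 1" "k' \<le> 1" "l' \<le> 1" using u(1) by (auto simp: V_def I_def)
    have e: "of_nat i' - A * of_nat l' = of_nat i - A * of_nat l"
      "of_nat j' - B * of_nat l' = of_nat j - B * of_nat l"
      "of_nat k' - C * of_nat l' = of_nat k - C * of_nat l"
      using u(1) by (auto simp: V_def v_def \<alpha>_def \<beta>_def \<gamma>_def)
    \<comment> \<open>Equal \<open>l\<close> would force equality of the other indices. So
      \<open>l\<close> flips, and as \<open>A\<close>, \<open>B\<close>, \<open>C\<close> are
      nonzero the others flip with it.\<close>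
    have ll: "l' \<noteq> l"
    proof
      assume "l' = l"
      thus False using e u(2) by (simp add: v_def)
    qed
    have "i' \<noteq> i" "j' \<noteq> j" "k' \<noteq> k" using e nz ll by auto
    hence eq: "i' = 1 - i" "j' = 1 - j" "k' = 1 - k" "l' = 1 - l"
      using le le' ll by linarith+
    have on: "of_nat (1 - n) = (1 :: complex) - of_nat n" if "n \<le> 1" for n using that by (simp add: of_nat_diff)
    have "c (1 - i) (1 - j) (1 - k) (1 - l) \<noteq> 0" using u(3) unfolding w_def q_def eq by simp
    thus ?thesis using e unfolding eq on[OF le(1)] on[OF le(2)] on[OF le(3)] on[OF le(4)]
      by (simp add: algebra_simps)
  qed
  have uniq: "i' = i \<and> j' = j \<and> k' = k"
    if "c i j k l \<noteq> 0" "c i' j' k' l \<noteq> 0" "i \<le> 1" "j \<le> 1" "k \<le> 1" "l \<le> 1" "i' \<le> 1" "j' \<le> 1" "k' \<le> 1"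
    for i j k l i' j' k'
  proof -
    have "(2 * of_nat i - 1 :: complex) = 2 * of_nat i' - 1" "(2 * of_nat j - 1 :: complex) = 2 * of_nat j' - 1"
      "(2 * of_nat k - 1 :: complex) = 2 * of_nat k' - 1"
      using key[OF that(1,3-6)] key[OF that(2,7-9,6)] by metis+
    thus ?thesis by simp
  qed
  have "\<exists>i j k l. i \<le> 1 \<and> j \<le> 1 \<and> k \<le> 1 \<and> l \<le> 1 \<and> c i j k l \<noteq> 0"
  proof (rule ccontr)
    assume "\<not> ?thesis"
    hence "G x y z t = 0" for x y z t unfolding c by (intro sum.neutral ballI) auto
    hence "G = (\<lambda>x y z t. 0)" by (intro ext)
    thus False using G0 by blast
  qed
  then obtain i0 j0 k0 l0 where v0: "i0 \<le> 1" "j0 \<le> 1" "k0 \<le> 1" "l0 \<le> 1" "c i0 j0 k0 l0 \<noteq> 0" by blast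
  \<comment> \<open>If the monomial found lacks \<open>t\<close>, its complement contains
    it.\<close>
  have "\<exists>i j k. i \<le> 1 \<and> j \<le> 1 \<and> k \<le> 1 \<and> c i j k 1 \<noteq> 0"
  proof (cases "l0 = 1")
    case False
    hence "1 - l0 = 1" using v0(4) by linarith
    hence "c (1 - i0) (1 - j0) (1 - k0) 1 \<noteq> 0" using key[OF v0(5,1-4)] by metis
    thus ?thesis by (intro exI[of _ "1 - i0"] exI[of _ "1 - j0"] exI[of _ "1 - k0"]) simp
  qed (use v0 in blast)
  then obtain i j k where le: "i \<le> 1" "j \<le> 1" "k \<le> 1" and p: "c i j k 1 \<noteq> 0" by blast
  have p': "c (1 - i) (1 - j) (1 - k) 0 \<noteq> 0" using key[OF p le] by simp
  have supp: "(i', j', k', l') \<in> {(i, j, k, 1), (1 - i, 1 - j, 1 - k, 0)}"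
    if "(i', j', k', l') \<in> I" "c i' j' k' l' \<noteq> 0" for i' j' k' l'
  proof -
    have m: "i' \<le> 1" "j' \<le> 1" "k' \<le> 1" "l' \<le> 1" using that(1) by (auto simp: I_def)
    hence "l' = 0 \<or> l' = 1" by linarith
    thus ?thesis
    proof
      assume "l' = 1"
      thus ?thesis using uniq[OF p, of i' j' k'] that(2) le m by simp
    next
      assume "l' = 0"
      thus ?thesis using uniq[OF p', of i' j' k'] that(2) le m by simp
    qed
  qed
  have "G x y z t = bin (c i j k 1) (c (1 - i) (1 - j) (1 - k) 0) i j k x y z t" for x y z t
  proof -
    have "G x y z t = (\<Sum>(i, j, k, l)\<in>{(i, j, k, 1), (1 - i, 1 - j, 1 - k, 0)}. c i j k l * x ^ i * y ^ j * z ^ k * t ^ l)"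
      unfolding G
    proof (rule sum.mono_neutral_right[OF fin])
      show "{(i, j, k, 1), (1 - i, 1 - j, 1 - k, 0)} \<subseteq> I" using le by (auto simp: I_def)
    qed (use supp in fastforce)
    thus ?thesis by (simp add: bin_def)
  qed
  thus ?thesis using p p' le
    by (intro exI[of _ "c i j k 1"] exI[of _ "c (1 - i) (1 - j) (1 - k) 0"] exI[of _ i] exI[of _ j] exI[of _ k])
      (auto simp: fun_eq_iff)
qed

section \<open>Integrating the reciprocal of a quadratic\<close>

text \<open>The double root may lie at infinity, in which case the quadratic is constant and
  \<open>f\<close> is affine. For a finite double root \<open>- r\<close> the reciprocal integrates
  to a multiple of \<open>1 / (x + r)\<close> plus a constant.\<close>

lemma square_denominator_moebius:
  assumes U: "open U" "connected U" "f holomorphic_on U"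
    and df: "\<And>x. x \<in> U \<Longrightarrow> deriv f x * (q0 + q1 * x + q2 * x\<^sup>2) = C" and C: "C \<noteq> 0"
    and disc: "q1\<^sup>2 = 4 * q0 * q2"
  shows "\<exists>c1 c2 c3 c4. c1 * c4 - c2 * c3 \<noteq> 0 \<and> (\<forall>x\<in>U. c3 * x + c4 \<noteq> 0 \<and> f x = moebius c1 c2 c3 c4 x)"
proof -
  have const: "\<exists>K. \<forall>x\<in>U. f x = g x + K"
    if g: "\<And>x. x \<in> U \<Longrightarrow> (g has_field_derivative deriv f x) (at x)" for g
  proof -
    have "((\<lambda>x. f x - g x) has_field_derivative 0) (at x)" if "x \<in> U" for x
      using DERIV_diff[OF holomorphic_derivI[OF U(3,1) that] g[OF that]] by simp
    hence "(\<lambda>x. f x - g x) constant_on U"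
      using has_field_derivative_0_imp_constant_on U by blast
    then obtain K where "\<And>x. x \<in> U \<Longrightarrow> f x - g x = K" unfolding constant_on_def by blast
    hence "\<forall>x\<in>U. f x = g x + K" by (metis add.commute diff_add_cancel)
    thus ?thesis ..
  qed
  show ?thesis
  proof (cases "q2 = 0")
    case True
    hence q1: "q1 = 0" using disc by simp
    show ?thesis
    proof (cases "U = {}")
      case True
      show ?thesis by (intro exI[of _ 1] exI[of _ 0] exI[of _ 0] exI[of _ 1]) (simp add: True)
    next
      case False
      hence q0: "q0 \<noteq> 0" using df True q1 C by auto
      have "((\<lambda>x. C / q0 * x) has_field_derivative deriv f x) (at x)" if "x \<in> U" for x
        using df[OF that] True q1 q0 by (auto intro!: derivative_eq_intros simp: field_simps)
      from const[OF this] obtain K where "\<forall>x\<in>U. f x = C / q0 * x + K" by blast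
      thus ?thesis using q0 C
        by (intro exI[of _ "C / q0"] exI[of _ K] exI[of _ 0] exI[of _ 1]) (simp add: moebius_def)
    qed
  next
    case False
    define r where "r = q1 / (2 * q2)"
    have "q0 + q1 * x + q2 * x\<^sup>2 = q2 * (x + r)\<^sup>2" for x
    proof -
      have "4 * q2 * (q0 + q1 * x + q2 * x\<^sup>2) = (2 * q2 * x + q1)\<^sup>2" using disc by algebra
      also have "\<dots> = 4 * q2 * (q2 * (x + r)\<^sup>2)"
        using False by (simp add: r_def field_simps power2_eq_square)
      finally show ?thesis using False by simp
    qed
    hence df': "deriv f x * (q2 * (x + r)\<^sup>2) = C" if "x \<in> U" for x using df[OF that] by simp
    have xr: "x + r \<noteq> 0" if "x \<in> U" for x using df'[OF that] C by auto
    have "((\<lambda>x. - (C / q2) / (x + r)) has_field_derivative deriv f x) (at x)" if "x \<in> U" for x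
    proof -
      have "deriv f x = C / (q2 * (x + r)\<^sup>2)"
        using xr[OF that] \<open>q2 \<noteq> 0\<close> df'[OF that] by (intro eq_divide_imp) simp_all
      hence "deriv f x = C / q2 / ((x + r) * (x + r))" by (simp add: power2_eq_square)
      thus ?thesis using xr[OF that] \<open>q2 \<noteq> 0\<close> by (auto intro!: derivative_eq_intros)
    qed
    from const[OF this] obtain K where K: "\<forall>x\<in>U. f x = - (C / q2) / (x + r) + K" by blast
    have "- u / (x + r) + K = moebius K (K * r - u) 1 r x" if "x \<in> U" for x u
      unfolding moebius_def using xr[OF that] by (simp add: field_simps)
    hence "f x = moebius K (K * r - C / q2) 1 r x" if "x \<in> U" for x
      using K that by metis
    thus ?thesis using xr False C
      by (intro exI[of _ K] exI[of _ "K * r - C / q2"] exI[of _ 1] exI[of _ r]) simp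
  qed
qed

text \<open>The Moebius function is the quotient of the two linear factors, or the single linear
  factor if the other root is infinite; its logarithmic derivative is a multiple of the reciprocal
  of the quadratic, hence of \<open>f'\<close>. The form of a differential equation avoids choosing
  a branch of the logarithm.\<close>

lemma simple_roots_logarithmic:
  fixes U :: "complex set"
  assumes df: "\<And>x. x \<in> U \<Longrightarrow> deriv f x * (q0 + q1 * x + q2 * x\<^sup>2) = C" and C: "C \<noteq> 0"
    and disc: "q1\<^sup>2 \<noteq> 4 * q0 * q2"
  shows "\<exists>c1 c2 c3 c4 m. c1 * c4 - c2 * c3 \<noteq> 0 \<and> m \<noteq> 0 \<and>
    (\<forall>x\<in>U. c3 * x + c4 \<noteq> 0 \<and> moebius c1 c2 c3 c4 x \<noteq> 0 \<and>
       (moebius c1 c2 c3 c4 has_field_derivative m * deriv f x * moebius c1 c2 c3 c4 x) (at x))"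
proof (cases "q2 = 0")
  case True
  hence q1: "q1 \<noteq> 0" using disc by auto
  have "q1 * x + q0 \<noteq> 0 \<and> (moebius q1 q0 0 1 has_field_derivative
      (q1 / C) * deriv f x * moebius q1 q0 0 1 x) (at x)" if "x \<in> U" for x
  proof -
    have e: "deriv f x * (q1 * x + q0) = C" using df[OF that] True by (simp add: add.commute)
    have "(q1 / C) * deriv f x * moebius q1 q0 0 1 x = q1"
      using e C by (simp add: moebius_def mult.assoc)
    moreover have "q1 * x + q0 \<noteq> 0" using e C by auto
    ultimately show ?thesis using moebius_deriv[of 0 x 1 q1 q0] by simp
  qed
  thus ?thesis using q1 C
    by (intro exI[of _ q1] exI[of _ q0] exI[of _ 0] exI[of _ 1] exI[of _ "q1 / C"])
      (simp add: moebius_def)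
next
  case False
  define s where "s = csqrt (q1\<^sup>2 - 4 * q0 * q2)"
  have s: "s\<^sup>2 = q1\<^sup>2 - 4 * q0 * q2" "s \<noteq> 0" using disc by (simp_all add: s_def)
  define r1 r2 where r: "r1 = (- q1 + s) / (2 * q2)" "r2 = (- q1 - s) / (2 * q2)"
  have rr: "r1 - r2 \<noteq> 0" using s False by (simp add: r field_simps)
  have r1: "2 * q2 * r1 = - q1 + s" "2 * q2 * r2 = - q1 - s" using False by (simp_all add: r)
  have fac: "q0 + q1 * x + q2 * x\<^sup>2 = q2 * (x - r1) * (x - r2)" for x
  proof -
    have "4 * q2 * (q0 + q1 * x + q2 * x\<^sup>2) = 4 * q2 * (q2 * (x - r1) * (x - r2))"
      using s(1) r1 by algebra
    thus ?thesis using False by simp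
  qed
  \<comment> \<open>By partial fractions the logarithmic derivative of the quotient is
    \<open>(r1 - r2) / ((x - r1) * (x - r2))\<close>.\<close>
  define m where "m = (r1 - r2) * q2 / C"
  have "1 * x + - r2 \<noteq> 0 \<and> 1 * x + - r1 \<noteq> 0 \<and> (moebius 1 (- r1) 1 (- r2) has_field_derivative
      m * deriv f x * moebius 1 (- r1) 1 (- r2) x) (at x)" if "x \<in> U" for x
  proof -
    have e: "deriv f x * (q2 * (x - r1) * (x - r2)) = C" using df[OF that] fac by simp
    have n: "x - r1 \<noteq> 0" "x - r2 \<noteq> 0" using e C by auto
    have d: "deriv f x = C / (q2 * (x - r1) * (x - r2))"
      using e n False by (intro eq_divide_imp) simp_all
    have "m * deriv f x * moebius 1 (- r1) 1 (- r2) x = (1 * - r2 - - r1 * 1) / (1 * x + - r2)\<^sup>2"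
      unfolding m_def d moebius_def using n C False by (simp add: power2_eq_square)
    thus ?thesis using moebius_deriv[of 1 x "- r2" 1 "- r1"] n by simp
  qed
  moreover have "m \<noteq> 0" using rr False C by (simp add: m_def)
  ultimately show ?thesis using rr
    by (intro exI[of _ 1] exI[of _ "- r1"] exI[of _ 1] exI[of _ "- r2"] exI[of _ m])
      (simp add: moebius_def)
qed

lemma linearizes_imp_bin:
  assumes ml: "multilinear E" and lin: "linearizes f U E" and not: "\<not> moebius_linearizable E"
  shows "\<exists>p p' i j k. p \<noteq> 0 \<and> p' \<noteq> 0 \<and> i \<le> 1 \<and> j \<le> 1 \<and> k \<le> 1 \<and> moebius_transformed E (bin p p' i j k)"
proof -
  have U: "open U" "connected U" "U \<noteq> {}" "f holomorphic_on U" "\<And>x. x \<in> U \<Longrightarrow> deriv f x \<noteq> 0"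
    using lin unfolding linearizes_def by auto
  obtain Z0 where "Z0 \<noteq> {}" "\<And>z. z \<in> Z0 \<Longrightarrow> \<exists>C. C \<noteq> 0 \<and> (\<forall>x\<in>U. deriv f x * disc E x z = C)"
    using linearizes_derivative[OF ml lin] by metis
  then obtain z0 C where C: "C \<noteq> 0" "\<forall>x\<in>U. deriv f x * disc E x z0 = C" by blast
  obtain q0 q1 q2 where q: "\<forall>x. disc E x z0 = q0 + q1 * x + q2 * x\<^sup>2"
    using disc_quadratic[OF ml] by blast
  have df: "deriv f x * (q0 + q1 * x + q2 * x\<^sup>2) = C" if "x \<in> U" for x
    using C(2) q that by metis
  \<comment> \<open>A double root would make \<open>f\<close> itself a Moebius function.\<close>
  have "q1\<^sup>2 \<noteq> 4 * q0 * q2"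
  proof
    assume "q1\<^sup>2 = 4 * q0 * q2"
    from square_denominator_moebius[OF U(1,2,4) df C(1) this]
    show False using lin not unfolding moebius_linearizable_def by blast
  qed
  from simple_roots_logarithmic[OF df C(1) this] obtain c1 c2 c3 c4 m where
    det: "c1 * c4 - c2 * c3 \<noteq> 0" and m: "m \<noteq> 0" and g: "\<forall>x\<in>U. c3 * x + c4 \<noteq> 0 \<and> moebius c1 c2 c3 c4 x \<noteq> 0 \<and>
       (moebius c1 c2 c3 c4 has_field_derivative m * deriv f x * moebius c1 c2 c3 c4 x) (at x)"
    by metis
  define h where "h = moebius c1 c2 c3 c4"
  have df': "(f has_field_derivative deriv f x) (at x)" if "x \<in> U" for x
    using holomorphic_derivI[OF U(4,1) that] .
  \<comment> \<open>\<open>h\<close> and \<open>exp (m * f x)\<close> satisfy the same linear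
    differential equation of first order, so their quotient is constant.\<close>
  have "((\<lambda>x. h x * exp (- m * f x)) has_field_derivative 0) (at x)" if "x \<in> U" for x
  proof -
    have "(h has_field_derivative m * deriv f x * h x) (at x)" using g that by (simp add: h_def)
    from DERIV_mult[OF this DERIV_chain2[OF DERIV_exp DERIV_cmult[OF df'[OF that], of "- m"]]]
    show ?thesis by (simp add: algebra_simps)
  qed
  hence "(\<lambda>x. h x * exp (- m * f x)) constant_on U"
    using has_field_derivative_0_imp_constant_on U by blast
  then obtain K where K: "\<And>x. x \<in> U \<Longrightarrow> h x * exp (- m * f x) = K" unfolding constant_on_def by blast
  have K0: "K \<noteq> 0" using K U(3) g by (force simp: h_def)
  define \<kappa> where "\<kappa> = Ln K"
  define \<phi> where "\<phi> = (\<lambda>x. m * f x + \<kappa>)"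
  have h: "h x = exp (\<phi> x)" if "x \<in> U" for x
    using K[OF that] K0 by (simp add: \<phi>_def \<kappa>_def exp_add exp_minus field_simps)
  obtain a b c d e X Y Z where nz: "a \<noteq> 0" "b \<noteq> 0" "c \<noteq> 0" "d \<noteq> 0"
    and op: "open X" "open Y" "open Z" and ne: "X \<noteq> {}" "Y \<noteq> {}" "Z \<noteq> {}"
    and sub: "X \<subseteq> U" "Y \<subseteq> U" "Z \<subseteq> U"
    and rel: "\<And>x y z. x \<in> X \<Longrightarrow> y \<in> Y \<Longrightarrow> z \<in> Z \<Longrightarrow> slope E x y z \<noteq> 0 \<and> sol E x y z \<in> U \<and>
       a * f x + b * f y + c * f z + d * f (sol E x y z) + e = 0"
    using linearizes_box[OF ml lin] by metis
  obtain G k where G: "multilinear G" and GE: "transformed_by k c1 c2 c3 c4 G E"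
    and EG: "moebius_transformed E G"
    using pullback[OF ml det] .
  \<comment> \<open>The constant that remains when the linear relation is solved for the exponent of
    the fourth variable.\<close>
  define \<tau> where "\<tau> = \<kappa> + (a + b + c) / d * \<kappa> - m * e / d"
  have van: "G (exp (\<phi> x)) (exp (\<phi> y)) (exp (\<phi> z))
      (exp (\<tau> - a / d * \<phi> x - b / d * \<phi> y - c / d * \<phi> z)) = 0"
    if p: "x \<in> X" "y \<in> Y" "z \<in> Z" for x y z
  proof -
    define t where "t = sol E x y z"
    note r = rel[OF p]
    have mem: "x \<in> U" "y \<in> U" "z \<in> U" "t \<in> U" using p sub r by (auto simp: t_def)
    have "E x y z t = 0" using sol_eq_iff[OF ml, of x y z t] r by (simp add: t_def)
    moreover have "E x y z t = k * ((c3 * x + c4) * (c3 * y + c4) * (c3 * z + c4) * (c3 * t + c4)) *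
        G (h x) (h y) (h z) (h t)"
      using transformed_byD(3)[OF GE, of x y z t] g mem by (simp add: h_def)
    ultimately have "G (h x) (h y) (h z) (h t) = 0"
      using g mem transformed_byD(1)[OF GE] by simp
    moreover have "\<phi> t = \<tau> - a / d * \<phi> x - b / d * \<phi> y - c / d * \<phi> z"
    proof -
      have "d * f t = - (a * f x + b * f y + c * f z + e)"
        using r unfolding t_def by algebra
      hence "d * (\<phi> t - (\<tau> - a / d * \<phi> x - b / d * \<phi> y - c / d * \<phi> z)) = 0"
        using nz(4) unfolding \<phi>_def \<tau>_def by (simp add: field_simps) algebra
      thus ?thesis using nz(4) by (simp only: mult_eq_0_iff right_minus_eq simp_thms)
    qed
    ultimately show ?thesis using mem by (simp add: h)
  qed
  have G0: "G \<noteq> (\<lambda>x y z t. 0)"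
  proof
    assume "G = (\<lambda>x y z t. 0)"
    hence "E = (\<lambda>x y z t. 0)" using transformed_by_zero[OF ml] GE by blast
    thus False using rel ne slope_nonzero_not_zero by blast
  qed
  have "\<exists>p p' i j k. p \<noteq> 0 \<and> p' \<noteq> 0 \<and> i \<le> 1 \<and> j \<le> 1 \<and> k \<le> 1 \<and> G = bin p p' i j k"
  proof (rule multilinear_vanishing_imp_bin[OF G G0 _ _ _ op ne _ _ van])
    show "a / d \<noteq> 0" "b / d \<noteq> 0" "c / d \<noteq> 0" using nz by auto
    fix x assume "x \<in> X \<union> Y \<union> Z"
    hence x: "x \<in> U" using sub by blast
    show "(\<phi> has_field_derivative m * deriv f x) (at x)"
      unfolding \<phi>_def by (auto intro!: derivative_eq_intros df'[OF x])
    show "m * deriv f x \<noteq> 0" using m U(5)[OF x] by simp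
  qed
  thus ?thesis using EG by metis
qed

section \<open>Logarithmic linearization of binomials\<close>

text \<open>Nonzero periods of \<open>exp\<close> have norm at least \<open>2 * pi\<close>. This
  provides the rigidity needed for logarithms.\<close>

lemma exp_eq_1_small:
  assumes "exp z = 1" "norm z < 1"
  shows "z = (0 :: complex)"
proof -
  from assms(1) obtain n :: int where n: "Re z = 0" "Im z = of_int (2 * n) * pi"
    unfolding exp_eq_1 by blast
  have "\<bar>Im z\<bar> < 1" using abs_Im_le_cmod[of z] assms(2) by linarith
  have "n = 0"
  proof (rule ccontr)
    assume "n \<noteq> 0"
    hence "1 \<le> \<bar>of_int n :: real\<bar>" by linarith
    hence "2 * pi \<le> \<bar>of_int (2 * n) * pi\<bar>" by (simp add: abs_mult)
    thus False using \<open>\<bar>Im z\<bar> < 1\<close> n pi_gt3 by linarith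
  qed
  thus ?thesis using n by (simp add: complex_eq_iff)
qed

text \<open>For real \<open>s\<close> the numbers \<open>L / 4 + s\<close> and
  \<open>L / 4 - s\<close> have imaginary part at most \<open>pi / 4\<close> in modulus, so the
  exponentials of these and of their negatives lie in the right half-plane, where \<open>Ln\<close>
  recovers the exponent. Only finitely many \<open>s\<close> produce the modulus of a point of
  \<open>S\<close>.\<close>

lemma exp_avoids_finite:
  fixes S :: "complex set"
  assumes "finite S" and L: "\<bar>Im L\<bar> \<le> pi"
  obtains \<eta>1 \<eta>2 where "2 * \<eta>1 + 2 * \<eta>2 = L"
    "\<And>\<eta>. \<eta> \<in> {\<eta>1, - \<eta>1, \<eta>2, - \<eta>2} \<Longrightarrow> Re (exp \<eta>) > 0 \<and> exp \<eta> \<notin> S \<and> Ln (exp \<eta>) = \<eta>"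
proof -
  define T where "T = (\<lambda>w. ln (cmod w)) ` S"
  define r where "r = Re L / 4"
  \<comment> \<open>The shifts \<open>s\<close> for which one of \<open>r + s\<close>,
    \<open>- (r + s)\<close>, \<open>r - s\<close>, \<open>- (r - s)\<close> falls into
    \<open>T\<close>.\<close>
  define N where "N = (\<lambda>\<tau>. \<tau> - r) ` T \<union> (\<lambda>\<tau>. - \<tau> - r) ` T \<union> (\<lambda>\<tau>. r - \<tau>) ` T \<union> (\<lambda>\<tau>. r + \<tau>) ` T"
  have "finite N" using assms(1) by (simp add: N_def T_def)
  from ex_new_if_finite[OF infinite_UNIV_char_0 this] obtain s where s: "s \<notin> N" ..
  define \<eta>1 \<eta>2 where \<eta>: "\<eta>1 = L / 4 + of_real s" "\<eta>2 = L / 4 - of_real s"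
  have mem: "\<tau> - r \<in> N" "- \<tau> - r \<in> N" "r - \<tau> \<in> N" "r + \<tau> \<in> N" if "\<tau> \<in> T" for \<tau>
    using that by (simp_all add: N_def)
  have notT: "r + s \<notin> T" "- (r + s) \<notin> T" "r - s \<notin> T" "- (r - s) \<notin> T"
    using mem(1)[of "r + s"] mem(2)[of "- (r + s)"] mem(3)[of "r - s"] mem(4)[of "- (r - s)"] s by auto
  have "Re (exp \<eta>) > 0 \<and> exp \<eta> \<notin> S \<and> Ln (exp \<eta>) = \<eta>"
    if "\<eta> \<in> {\<eta>1, - \<eta>1, \<eta>2, - \<eta>2}" for \<eta>
  proof -
    have im: "\<bar>Im \<eta>\<bar> \<le> pi / 4" using that L by (auto simp: \<eta>)
    have "Re \<eta> \<in> {r + s, - (r + s), r - s, - (r - s)}" using that by (auto simp: \<eta> r_def)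
    hence "Re \<eta> \<notin> T" using notT by auto
    moreover have "ln (cmod (exp \<eta>)) = Re \<eta>" by simp
    ultimately have "exp \<eta> \<notin> S" unfolding T_def by (metis image_eqI)
    moreover have "cos (Im \<eta>) > 0" using im pi_gt_zero by (intro cos_gt_zero_pi) linarith+
    hence "Re (exp \<eta>) > 0" by (simp add: Re_exp)
    moreover have "Ln (exp \<eta>) = \<eta>" using im pi_gt_zero by (intro Ln_exp) linarith+
    ultimately show ?thesis by blast
  qed
  moreover have "2 * \<eta>1 + 2 * \<eta>2 = L" by (simp add: \<eta>)
  ultimately show ?thesis using that by blast
qed

text \<open>For \<open>i \<le> 1\<close> this is \<open>2 * i - 1\<close>, the exponent of a
  variable in the quotient of the two monomials of \<open>bin\<close>.\<close>

definition sgn_exp :: "nat \<Rightarrow> complex" where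
  "sgn_exp i = (if i = 0 then - 1 else 1)"

lemma sgn_exp_simps [simp]: "sgn_exp i * sgn_exp i = 1" "sgn_exp i \<noteq> 0"
  by (auto simp: sgn_exp_def)

lemma exp_sgn_Ln:
  assumes "i \<le> 1" "x \<noteq> 0"
  shows "exp (sgn_exp i * Ln x) = x ^ i / x ^ (1 - i)"
proof -
  have "i = 0 \<or> i = 1" using assms(1) by linarith
  thus ?thesis using assms(2) by (auto simp: sgn_exp_def exp_minus field_simps)
qed

text \<open>The quotient of the two monomials is a Laurent monomial with exponents 1 and -1, and the
  linear form is a logarithm of it.\<close>

lemma bin_zero_iff:
  assumes "i \<le> 1" "j \<le> 1" "k \<le> 1" "p \<noteq> 0" "x \<noteq> 0" "y \<noteq> 0" "z \<noteq> 0" "t \<noteq> 0"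
  shows "bin p p' i j k x y z t = 0 \<longleftrightarrow>
    exp (sgn_exp i * Ln x + sgn_exp j * Ln y + sgn_exp k * Ln z + Ln t) = - p' / p"
proof -
  have "exp (sgn_exp i * Ln x + sgn_exp j * Ln y + sgn_exp k * Ln z + Ln t) =
      (x ^ i / x ^ (1 - i)) * (y ^ j / y ^ (1 - j)) * (z ^ k / z ^ (1 - k)) * t"
    unfolding exp_add exp_sgn_Ln[OF assms(1,5)] exp_sgn_Ln[OF assms(2,6)] exp_sgn_Ln[OF assms(3,7)]
      exp_Ln[OF assms(8)] ..
  also have "\<dots> = - p' / p \<longleftrightarrow> p * x ^ i * y ^ j * z ^ k * t = - p' * x ^ (1 - i) * y ^ (1 - j) * z ^ (1 - k)"
  proof -
    have "(x ^ i / x ^ (1 - i)) * (y ^ j / y ^ (1 - j)) * (z ^ k / z ^ (1 - k)) * t =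
        (x ^ i * y ^ j * z ^ k * t) / (x ^ (1 - i) * y ^ (1 - j) * z ^ (1 - k))" by simp
    also have "\<dots> = - p' / p \<longleftrightarrow>
        (x ^ i * y ^ j * z ^ k * t) * p = - p' * (x ^ (1 - i) * y ^ (1 - j) * z ^ (1 - k))"
      using assms(4-7) by (intro frac_eq_eq) auto
    finally show ?thesis by (simp only: mult_ac)
  qed
  finally show ?thesis by (simp add: bin_def eq_neg_iff_add_eq_0)
qed

lemma bin_imp_point_linearizable:
  assumes ml: "multilinear E" and nz: "p \<noteq> 0" "p' \<noteq> 0" and le: "i \<le> 1" "j \<le> 1" "k \<le> 1"
    and tr: "moebius_transformed E (bin p p' i j k)"
  shows "point_linearizable E"
proof -
  from moebius_transformed_sym[OF tr] obtain \<kappa> c1 c2 c3 c4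
    where GE: "transformed_by \<kappa> c1 c2 c3 c4 (bin p p' i j k) E"
    unfolding moebius_transformed_iff by blast
  note \<kappa> = transformed_byD(1)[OF GE] and det = transformed_byD(2)[OF GE] and E = transformed_byD(3)[OF GE]
  define g where "g = moebius c1 c2 c3 c4"
  define h where "h = moebius c4 (- c2) (- c3) c1"
  define S where "S = {v. - c3 * v + c1 = 0}"
  \<comment> \<open>\<open>S\<close> contains the value, if any, that \<open>g\<close> omits.
    Without it \<open>h\<close> and \<open>g\<close> are mutually inverse between \<open>V\<close>
    and \<open>U\<close>, which transports connectedness to \<open>U\<close>.\<close>
  define V where "V = {v. Re v > 0} - S"
  define U where "U = {u. c3 * u + c4 \<noteq> 0 \<and> Re (g u) > 0}"
  define f where "f = (\<lambda>u. Ln (g u))"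
  have finS: "finite S" unfolding S_def by (rule finite_linear_roots) (use det in auto)
  have hU: "h v \<in> U" "g (h v) = v" if "v \<in> V" for v
    using moebius_denominator(2,3)[OF det, of v] that unfolding h_def g_def U_def V_def S_def by auto
  have gV: "g u \<in> V \<and> h (g u) = u" if "u \<in> U" for u
  proof -
    have u: "c3 * u + c4 \<noteq> 0" "Re (g u) > 0" using that by (auto simp: U_def)
    have det': "c4 * c1 - - c2 * - c3 \<noteq> 0" using det by (simp add: algebra_simps)
    have "- c3 * moebius c1 (- (- c2)) (- (- c3)) c4 u + c1 \<noteq> 0"
      "moebius c4 (- c2) (- c3) c1 (moebius c1 (- (- c2)) (- (- c3)) c4 u) = u"
      using moebius_denominator(2,3)[OF det', of u] u(1) by auto
    thus ?thesis using u(2) by (simp add: g_def h_def V_def S_def)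
  qed
  have "connected {v. Re v > 0}" by (intro convex_connected convex_halfspace_Re_gt)
  hence cV: "connected V" unfolding V_def using finS
    by (intro connected_open_delete_finite open_halfspace_Re_gt) auto
  have "continuous_on V h"
    unfolding h_def moebius_def by (intro continuous_intros) (auto simp: V_def S_def)
  moreover have "U = h ` V" using hU(1) gV by (metis (no_types, opaque_lifting) image_iff subsetI subset_antisym)
  ultimately have cU: "connected U" using connected_continuous_image cV by blast
  have "finite {u. c3 * u + c4 = 0}" by (rule finite_linear_roots) (use det in auto)
  hence oN: "open (- {u. c3 * u + c4 = 0})" by (intro open_Compl finite_imp_closed)
  have dg: "(g has_field_derivative (c1 * c4 - c2 * c3) / (c3 * x + c4)\<^sup>2) (at x)"
    if "c3 * x + c4 \<noteq> 0" for x
    using moebius_deriv that unfolding g_def by blast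
  have "continuous_on (- {u. c3 * u + c4 = 0}) g"
    using dg by (intro continuous_at_imp_continuous_on ballI DERIV_isCont) auto
  hence "open (- {u. c3 * u + c4 = 0} \<inter> g -` {v. Re v > 0})"
    by (intro continuous_open_preimage oN open_halfspace_Re_gt)
  moreover have "U = - {u. c3 * u + c4 = 0} \<inter> g -` {v. Re v > 0}" by (auto simp: U_def)
  ultimately have oU: "open U" by simp
  have df: "(f has_field_derivative (c1 * c4 - c2 * c3) / (c3 * x + c4)\<^sup>2 / g x) (at x)" if "x \<in> U" for x
  proof -
    have "g x \<notin> \<real>\<^sub>\<le>\<^sub>0" using that by (auto simp: U_def complex_nonpos_Reals_iff)
    from DERIV_chain2[OF has_field_derivative_Ln[OF this] dg] show ?thesis
      using that by (simp add: f_def U_def field_simps)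
  qed
  have hol: "f holomorphic_on U" using df oU by (auto simp: holomorphic_on_open)
  have dn: "deriv f x \<noteq> 0" if "x \<in> U" for x
    using DERIV_imp_deriv[OF df[OF that]] det that by (auto simp: U_def)
  define L where "L = Ln (- p' / p)"
  have gn: "g u \<noteq> 0" if "u \<in> U" for u using that by (auto simp: U_def)
  have Ezero: "E x y z t = 0 \<longleftrightarrow> exp (sgn_exp i * f x + sgn_exp j * f y + sgn_exp k * f z + 1 * f t) = exp L"
    if m: "x \<in> U" "y \<in> U" "z \<in> U" "t \<in> U" for x y z t
  proof -
    have "E x y z t = 0 \<longleftrightarrow> bin p p' i j k (g x) (g y) (g z) (g t) = 0"
      using E[of x y z t] m \<kappa> by (simp add: U_def g_def)
    also have "\<dots> \<longleftrightarrow> exp (sgn_exp i * f x + sgn_exp j * f y + sgn_exp k * f z + f t) = - p' / p"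
      unfolding f_def by (rule bin_zero_iff[OF le nz(1)]) (use gn m in auto)
    also have "- p' / p = exp L" using nz by (simp add: L_def)
    finally show ?thesis by simp
  qed
  have "\<bar>Im L\<bar> \<le> pi"
    using mpi_less_Im_Ln[of "- p' / p"] Im_Ln_le_pi[of "- p' / p"] nz by (simp add: L_def abs_le_iff)
  from exp_avoids_finite[OF finS this] obtain \<eta>1 \<eta>2 where \<eta>: "2 * \<eta>1 + 2 * \<eta>2 = L"
    "\<And>\<eta>. \<eta> \<in> {\<eta>1, - \<eta>1, \<eta>2, - \<eta>2} \<Longrightarrow> Re (exp \<eta>) > 0 \<and> exp \<eta> \<notin> S \<and> Ln (exp \<eta>) = \<eta>" by metis
  \<comment> \<open>A point at which \<open>f\<close> equals \<open>sgn_exp i * \<eta>\<close>; the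
    sign cancels against the coefficient in the linear form, so the four contributions add up to
    \<open>L\<close>.\<close>
  define P where "P = (\<lambda>i \<eta>. h (exp (sgn_exp i * \<eta>)))"
  have P: "P i \<eta> \<in> U \<and> f (P i \<eta>) = sgn_exp i * \<eta>" if "\<eta> \<in> {\<eta>1, \<eta>2}" for i \<eta>
  proof -
    have "sgn_exp i * \<eta> \<in> {\<eta>1, - \<eta>1, \<eta>2, - \<eta>2}" using that by (auto simp: sgn_exp_def)
    note m = \<eta>(2)[OF this]
    hence "exp (sgn_exp i * \<eta>) \<in> V" by (simp add: V_def)
    from hU[OF this] m show ?thesis by (simp add: P_def f_def)
  qed
  have P1: "P n \<eta>1 \<in> U" "f (P n \<eta>1) = sgn_exp n * \<eta>1" and P2: "P n \<eta>2 \<in> U" "f (P n \<eta>2) = sgn_exp n * \<eta>2" for n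
    using P by auto
  have sum: "sgn_exp i * f (P i \<eta>1) + sgn_exp j * f (P j \<eta>2) + sgn_exp k * f (P k \<eta>1) + 1 * f (P 1 \<eta>2) = L"
    unfolding P1 P2 mult.assoc[symmetric] sgn_exp_simps using \<eta>(1) by (simp add: sgn_exp_def algebra_simps)
  have pt: "E (P i \<eta>1) (P j \<eta>2) (P k \<eta>1) (P 1 \<eta>2) = 0"
    using Ezero[OF P1(1) P2(1) P1(1) P2(1)] sum by simp
  have "infinite U" using open_nonempty_infinite[OF oU] P1(1) by blast
  hence "U - {P 1 \<eta>2} \<noteq> {}" by (metis infinite_remove finite.emptyI)
  then obtain t1 where t1: "t1 \<in> U" "t1 \<noteq> P 1 \<eta>2" by blast
  have n1: "E (P i \<eta>1) (P j \<eta>2) (P k \<eta>1) t1 \<noteq> 0"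
  proof
    assume "E (P i \<eta>1) (P j \<eta>2) (P k \<eta>1) t1 = 0"
    hence "exp (sgn_exp i * f (P i \<eta>1) + sgn_exp j * f (P j \<eta>2) + sgn_exp k * f (P k \<eta>1) + 1 * f t1) =
       exp (sgn_exp i * f (P i \<eta>1) + sgn_exp j * f (P j \<eta>2) + sgn_exp k * f (P k \<eta>1) + 1 * f (P 1 \<eta>2))"
      using Ezero[OF P1(1) P2(1) P1(1) t1(1)] sum by simp
    hence "exp (f t1) = exp (f (P 1 \<eta>2))" by (simp add: exp_add)
    moreover have "exp (f u) = g u" if "u \<in> U" for u using gn[OF that] by (simp add: f_def)
    ultimately have "g t1 = g (P 1 \<eta>2)" using t1(1) P2(1) by simp
    thus False using gV t1 P2(1) by metis
  qed
  have "linearizes f U E"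
  proof (rule linearizes_intro[OF ml oU cU hol dn P1(1) P2(1) P1(1) P2(1) pt n1])
    show "sgn_exp i \<noteq> 0" "sgn_exp j \<noteq> 0" "sgn_exp k \<noteq> 0" "(1 :: complex) \<noteq> 0" by simp_all
    show "sgn_exp i * f (P i \<eta>1) + sgn_exp j * f (P j \<eta>2) + sgn_exp k * f (P k \<eta>1) + 1 * f (P 1 \<eta>2) + - L = 0"
      using sum by simp
    \<comment> \<open>\<open>E = 0\<close> fixes the form modulo periods of \<open>exp\<close>, and
      the bound leaves only the value zero.\<close>
    fix x y z t assume m: "x \<in> U" "y \<in> U" "z \<in> U" "t \<in> U" and "E x y z t = 0"
      and small: "cmod (sgn_exp i * f x + sgn_exp j * f y + sgn_exp k * f z + 1 * f t + - L) < 1"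
    hence "exp (sgn_exp i * f x + sgn_exp j * f y + sgn_exp k * f z + 1 * f t) = exp L"
      using Ezero by blast
    hence "exp (sgn_exp i * f x + sgn_exp j * f y + sgn_exp k * f z + 1 * f t + - L) = 1"
      unfolding exp_add[of _ "- L"] exp_minus by simp
    from exp_eq_1_small[OF this small]
    show "sgn_exp i * f x + sgn_exp j * f y + sgn_exp k * f z + 1 * f t + - L = 0" .
  qed
  thus ?thesis unfolding point_linearizable_def by blast
qed

section \<open>The discriminant as an obstruction to Moebius linearization\<close>

text \<open>\<open>disc\<close> is minus the determinant of a bilinear form in \<open>(1, y)\<close>
  and \<open>(1, t)\<close>; evaluating at \<open>u\<close>, \<open>v\<close> in place of 0, 1
  multiplies it by \<open>(u - v)\<^sup>2\<close>. The freedom in \<open>u\<close> and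
  \<open>v\<close> serves to avoid poles of a Moebius map.\<close>

lemma disc_difference:
  assumes ml: "multilinear E"
  shows "disc E x z * (u - v)\<^sup>2 = E x u z v * E x v z u - E x u z u * E x v z v"
proof -
  have y: "E x y z t = E x 0 z t + y * (E x 1 z t - E x 0 z t)" for y t
    using affine1_eq[OF multilinear_affineD(2)[OF ml]] .
  have t: "E x y z t = E x y z 0 + t * (E x y z 1 - E x y z 0)" for y t
    using affine1_eq[OF multilinear_affineD(4)[OF ml]] .
  define e0 e1 e2 e3 where e: "e0 = E x 0 z 0" "e1 = E x 1 z 0" "e2 = E x 0 z 1" "e3 = E x 1 z 1"
  have E: "E x y z t = (e0 + t * (e2 - e0)) + y * ((e1 + t * (e3 - e1)) - (e0 + t * (e2 - e0)))" for y t
    unfolding e using y[of y t] t[of 0 t] t[of 1 t] by simp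
  show ?thesis unfolding disc_def E by algebra
qed

text \<open>The two monomials multiply to \<open>x * z\<close> in the remaining variables. As a
  quadratic in \<open>x\<close> the roots are 0 and infinity, for nonzero \<open>z\<close>.\<close>

lemma disc_bin:
  assumes "p \<noteq> 0" "p' \<noteq> 0" "i \<le> 1" "j \<le> 1" "k \<le> 1"
  shows "\<exists>\<rho>. \<rho> \<noteq> 0 \<and> (\<forall>x z. disc (bin p p' i j k) x z = \<rho> * x * z)"
proof -
  have c: "i = 0 \<or> i = 1" "j = 0 \<or> j = 1" "k = 0 \<or> k = 1" using assms by linarith+
  show ?thesis
  proof (cases "j = 0")
    case True
    thus ?thesis using c assms
      by (intro exI[of _ "p * p'"]) (auto simp: disc_def bin_def mult_ac)
  next
    case False
    hence "j = 1" using c by simp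
    thus ?thesis using c assms
      by (intro exI[of _ "- (p * p')"]) (auto simp: disc_def bin_def algebra_simps)
  qed
qed

text \<open>
  For binomials the quadratic \<open>disc E _ z\<close> has two simple roots on the sphere, whereas linearization
  by a Moebius function forces a double root.
\<close>

lemma bin_imp_not_moebius_linearizable:
  assumes ml: "multilinear E" and nz: "p \<noteq> 0" "p' \<noteq> 0" and le: "i \<le> 1" "j \<le> 1" "k \<le> 1"
    and tr: "moebius_transformed E (bin p p' i j k)"
  shows "\<not> moebius_linearizable E"
proof
  assume "moebius_linearizable E"
  then obtain f U d1 d2 d3 d4 where lin: "linearizes f U E" and det': "d1 * d4 - d2 * d3 \<noteq> 0"
    and f: "\<And>x. x \<in> U \<Longrightarrow> d3 * x + d4 \<noteq> 0 \<and> f x = moebius d1 d2 d3 d4 x"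
    unfolding moebius_linearizable_def by blast
  have U: "open U" "U \<noteq> {}" using lin unfolding linearizes_def by auto
  from moebius_transformed_sym[OF tr] obtain \<kappa> c1 c2 c3 c4
    where GE: "transformed_by \<kappa> c1 c2 c3 c4 (bin p p' i j k) E"
    unfolding moebius_transformed_iff by blast
  note \<kappa> = transformed_byD(1)[OF GE] and det = transformed_byD(2)[OF GE] and E = transformed_byD(3)[OF GE]
  define g where "g = moebius c1 c2 c3 c4"
  define S where "S = {u. c3 * u + c4 = 0}"
  have finS: "finite S" unfolding S_def by (rule finite_linear_roots) (use det in auto)
  have finS': "finite {u. c1 * u + c2 = 0}" by (rule finite_linear_roots) (use det in auto)
  obtain Z where Z: "open Z" "Z \<noteq> {}" "\<And>z. z \<in> Z \<Longrightarrow> \<exists>C. C \<noteq> 0 \<and> (\<forall>x\<in>U. deriv f x * disc E x z = C)"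
    using linearizes_derivative[OF ml lin] by metis
  have "infinite (Z - (S \<union> {u. c1 * u + c2 = 0}))"
    using open_nonempty_infinite[OF Z(1,2)] finS finS' by (intro Diff_infinite_finite) auto
  \<comment> \<open>Such a \<open>z\<close> has a finite nonzero image under \<open>g\<close>, so
    the discriminant of the binomial is not identically zero there.\<close>
  then obtain z where z: "z \<in> Z" "c3 * z + c4 \<noteq> 0" "c1 * z + c2 \<noteq> 0"
    unfolding S_def using infinite_imp_nonempty by blast
  from Z(3)[OF z(1)] obtain C where C: "C \<noteq> 0" "\<forall>x\<in>U. deriv f x * disc E x z = C" by blast
  have "infinite (UNIV - S)" using finS infinite_UNIV_char_0 by (intro Diff_infinite_finite) auto
  then obtain u where u: "u \<in> UNIV - S" using infinite_imp_nonempty by blast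
  have "infinite (UNIV - S - {u})" using \<open>infinite (UNIV - S)\<close> by (intro infinite_remove)
  then obtain v where v: "v \<in> UNIV - S - {u}" using infinite_imp_nonempty by blast
  have uv: "c3 * u + c4 \<noteq> 0" "c3 * v + c4 \<noteq> 0" "u \<noteq> v" using u v by (auto simp: S_def)
  have guv: "g u \<noteq> g v" using inj_onD[OF moebius_inj[OF det], of u v] uv by (auto simp: g_def)
  have gz: "g z \<noteq> 0" using z by (simp add: g_def moebius_def)
  obtain \<rho> where \<rho>: "\<rho> \<noteq> 0" "\<And>x z. disc (bin p p' i j k) x z = \<rho> * x * z"
    using disc_bin[OF nz le] by blast
  define \<Gamma> where "\<Gamma> = \<kappa>\<^sup>2 * \<rho> * (c3 * z + c4)\<^sup>2 * g z * (c3 * u + c4)\<^sup>2 * (c3 * v + c4)\<^sup>2 * ((g u - g v)\<^sup>2 / (u - v)\<^sup>2)"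
  have \<Gamma>: "\<Gamma> \<noteq> 0" using \<kappa> \<rho> z(2) gz uv guv by (simp add: \<Gamma>_def)
  \<comment> \<open>The roots 0 and infinity are pulled back to the zero and the pole of
    \<open>g\<close>.\<close>
  have disc_E: "disc E x z = \<Gamma> * ((c1 * x + c2) * (c3 * x + c4))" if x: "c3 * x + c4 \<noteq> 0" for x
  proof -
    define B where "B = bin p p' i j k"
    define N where "N = (\<lambda>x. c3 * x + c4)"
    have E': "E x u' z v' = \<kappa> * (N x * N u' * N z * N v') * B (g x) (g u') (g z) (g v')"
      if "u' \<in> {u, v}" "v' \<in> {u, v}" for u' v'
      using E[of x u' z v'] that x z uv by (auto simp: g_def B_def N_def)
    have "disc E x z * (u - v)\<^sup>2 = E x u z v * E x v z u - E x u z u * E x v z v"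
      by (rule disc_difference[OF ml])
    also have "\<dots> = (\<kappa> * N x * N z * N u * N v)\<^sup>2 *
        (B (g x) (g u) (g z) (g v) * B (g x) (g v) (g z) (g u) - B (g x) (g u) (g z) (g u) * B (g x) (g v) (g z) (g v))"
      unfolding E'[OF insertI1 insertI2[OF insertI1]] E'[OF insertI2[OF insertI1] insertI1]
        E'[OF insertI1 insertI1] E'[OF insertI2[OF insertI1] insertI2[OF insertI1]]
      by algebra
    also have "\<dots> = (\<kappa> * N x * N z * N u * N v)\<^sup>2 * (\<rho> * g x * g z * (g u - g v)\<^sup>2)"
      using disc_difference[OF multilinear_bin[OF le], of p p' "g x" "g z" "g u" "g v"]
      unfolding \<rho>(2) B_def by simp
    also have "\<dots> = (\<Gamma> * (u - v)\<^sup>2) * (N x * (N x * g x))"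
      using uv(3) by (simp add: \<Gamma>_def N_def power_mult_distrib) (simp add: power2_eq_square)
    also have "N x * g x = c1 * x + c2" using x by (simp add: N_def g_def moebius_def)
    finally have "(u - v)\<^sup>2 * disc E x z = (u - v)\<^sup>2 * (\<Gamma> * ((c1 * x + c2) * (c3 * x + c4)))"
      by (simp add: N_def mult_ac)
    thus ?thesis using uv(3) by simp
  qed
  define K where "K = (d1 * d4 - d2 * d3) * \<Gamma>"
  have K: "K \<noteq> 0" using det' \<Gamma> by (simp add: K_def)
  \<comment> \<open>A Moebius function \<open>f\<close> makes the same quadratic proportional to the
    square of \<open>d3 * x + d4\<close>; the coefficients are compared.\<close>
  have "(K * c2 * c4 - C * d4\<^sup>2) + (K * (c1 * c4 + c2 * c3) - 2 * C * d3 * d4) * x + (K * c1 * c3 - C * d3\<^sup>2) * x\<^sup>2 = 0"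
    if x: "x \<in> U - S" for x
  proof -
    have xU: "x \<in> U" "c3 * x + c4 \<noteq> 0" using x by (auto simp: S_def)
    have n: "d3 * x + d4 \<noteq> 0" using f xU by blast
    have "(f has_field_derivative (d1 * d4 - d2 * d3) / (d3 * x + d4)\<^sup>2) (at x)"
      by (rule has_field_derivative_transform_within_open[OF moebius_deriv[OF n] U(1) xU(1)]) (use f in simp)
    hence "deriv f x = (d1 * d4 - d2 * d3) / (d3 * x + d4)\<^sup>2" by (rule DERIV_imp_deriv)
    hence "(d1 * d4 - d2 * d3) / (d3 * x + d4)\<^sup>2 * (\<Gamma> * ((c1 * x + c2) * (c3 * x + c4))) = C"
      using C(2) xU disc_E by metis
    hence "(d1 * d4 - d2 * d3) * (\<Gamma> * ((c1 * x + c2) * (c3 * x + c4))) = C * (d3 * x + d4)\<^sup>2"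
      using n by (simp add: divide_eq_eq)
    thus ?thesis unfolding K_def by algebra
  qed
  moreover have "infinite (U - S)"
    using open_nonempty_infinite[OF U] finS by (rule Diff_infinite_finite[rotated])
  ultimately have "K * c2 * c4 = C * d4\<^sup>2" "K * (c1 * c4 + c2 * c3) = 2 * C * d3 * d4" "K * c1 * c3 = C * d3\<^sup>2"
    using quadratic_zero[of "U - S" "K * c2 * c4 - C * d4\<^sup>2" "K * (c1 * c4 + c2 * c3) - 2 * C * d3 * d4"
       "K * c1 * c3 - C * d3\<^sup>2"] by simp_all
  \<comment> \<open>The discriminant of \<open>(c1 * x + c2) * (c3 * x + c4)\<close> is the squared
    determinant, while that of a square is zero.\<close>
  hence "K\<^sup>2 * (c1 * c4 - c2 * c3)\<^sup>2 = 0" by algebra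
  thus False using K det by simp
qed

section \<open>Normal forms of binomials under scaling and exchange\<close>

text \<open>Scaling multiplies each monomial by a power of \<open>\<mu>\<close> given by its degree,
  so the ratio of the coefficients can be normalized whenever the two degrees differ.\<close>

lemma bin_scale:
  assumes "\<kappa> \<noteq> 0" "\<mu> \<noteq> 0"
  shows "moebius_transformed (bin p p' i j k)
    (bin (\<kappa> * p * \<mu> ^ (i + j + k + 1)) (\<kappa> * p' * \<mu> ^ ((1 - i) + (1 - j) + (1 - k))) i j k)"
proof -
  have "transformed_by \<kappa> \<mu> 0 0 1 (bin p p' i j k)
    (bin (\<kappa> * p * \<mu> ^ (i + j + k + 1)) (\<kappa> * p' * \<mu> ^ ((1 - i) + (1 - j) + (1 - k))) i j k)"
    using assms unfolding transformed_by_def bin_def moebius_def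
    by (simp add: power_mult_distrib power_add algebra_simps)
  thus ?thesis unfolding moebius_transformed_iff by blast
qed

lemma eq_bin:
  "eq_a = bin 1 (- 1) 1 1 1" "eq_b = bin (- 1) 1 0 1 1" "eq_c = bin (- 1) 1 1 0 1"
  "eq_d = bin 1 (- 1) 0 0 0" "eq_e \<theta> = bin 1 (- \<theta>) 0 0 1" "eq_f \<theta> = bin 1 (- \<theta>) 1 0 0"
  by (auto simp: fun_eq_iff eq_a_def eq_b_def eq_c_def eq_d_def eq_e_def eq_f_def bin_def)

lemma exchange_bin: "exchange (bin p p' i j k) = bin p p' i k j"
  by (auto simp: fun_eq_iff exchange_def bin_def mult_ac)

text \<open>The eight exponent patterns form six classes under the exchange. In four of them the
  degrees of the monomials differ and scaling removes both coefficients; in the other two both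
  degrees are two, and the ratio survives as \<open>\<theta>\<close>.\<close>

lemma moebius_transformed_bin_iff:
  assumes ml: "multilinear E"
  shows "(\<exists>p p' i j k. p \<noteq> 0 \<and> p' \<noteq> 0 \<and> i \<le> 1 \<and> j \<le> 1 \<and> k \<le> 1 \<and> moebius_transformed E (bin p p' i j k)) \<longleftrightarrow>
    equivalent E eq_a \<or> equivalent E eq_b \<or> equivalent E eq_c \<or> equivalent E eq_d \<or>
    (\<exists>\<theta>. \<theta> \<noteq> 0 \<and> equivalent E (eq_e \<theta>)) \<or> (\<exists>\<theta>. \<theta> \<noteq> 0 \<and> equivalent E (eq_f \<theta>))"
    (is "?L \<longleftrightarrow> ?R")
proof
  have iff: "equivalent E (bin p p' i j k) \<longleftrightarrow>
      moebius_transformed E (bin p p' i j k) \<or> moebius_transformed E (bin p p' i k j)"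
    if "i \<le> 1" "j \<le> 1" "k \<le> 1" for p p' i j k
    using ml multilinear_bin[OF that] unfolding equivalent_iff exchange_bin by blast
  {
    assume ?L
    then obtain p p' i j k where nz: "p \<noteq> 0" "p' \<noteq> 0" and le: "i \<le> 1" "j \<le> 1" "k \<le> 1"
      and tr: "moebius_transformed E (bin p p' i j k)" by blast
    have scale: "moebius_transformed E (bin q q' i j k)"
      if "\<kappa> \<noteq> 0" "\<mu> \<noteq> 0" "\<kappa> * p * \<mu> ^ (i + j + k + 1) = q" "\<kappa> * p' * \<mu> ^ ((1 - i) + (1 - j) + (1 - k)) = q'"
      for \<kappa> \<mu> q q'
      using moebius_transformed_trans[OF ml multilinear_bin[OF le] tr bin_scale[OF that(1,2)]]
      unfolding that(3,4) .
    have pair: "moebius_transformed E (bin 1 (- (- p' / p)) i j k)" if "i + j + k = 1"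
    proof (rule scale[of "1 / p" 1])
    qed (use nz in auto)
    \<comment> \<open>\<open>s\<close> is a square root and \<open>r\<close> below a fourth root of
      \<open>- p' / p\<close>, for monomials whose degrees differ by two and by four.\<close>
    define s where "s = csqrt (- p' / p)"
    have s: "s\<^sup>2 = - p' / p" "s \<noteq> 0" using nz by (simp_all add: s_def)
    define r where "r = csqrt s"
    have r: "r\<^sup>2 = s" "r \<noteq> 0" using s by (simp_all add: r_def)
    have ps: "p * s\<^sup>2 = - p'" using s nz by simp
    have odd: "moebius_transformed E (bin (- 1) 1 i j k)" if "i + j + k = 2"
    proof (rule scale[of "1 / (p' * s)" s])
      have "(1 - i) + (1 - j) + (1 - k) = 1" using that le by linarith
      thus "1 / (p' * s) * p' * s ^ ((1 - i) + (1 - j) + (1 - k)) = 1" using nz s by simp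
      have "1 / (p' * s) * p * s ^ (i + j + k + 1) = (p * s\<^sup>2) * s / (p' * s)"
        unfolding that by (simp add: eval_nat_numeral)
      thus "1 / (p' * s) * p * s ^ (i + j + k + 1) = - 1" unfolding ps using nz s by simp
    qed (use nz s in auto)
    have "i = 0 \<or> i = 1" "j = 0 \<or> j = 1" "k = 0 \<or> k = 1" using le by linarith+
    then consider "i = 1" "j = 1" "k = 1" | "i = 0" "j = 1" "k = 1" | "i = 1" "j = 0" "k = 1" | "i = 1" "j = 1" "k = 0"
      | "i = 0" "j = 0" "k = 0" | "i = 0" "j = 0" "k = 1" | "i = 0" "j = 1" "k = 0" | "i = 1" "j = 0" "k = 0"
      by blast
    thus ?R
    proof cases
      case 1
      have "moebius_transformed E (bin 1 (- 1) i j k)"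
      proof (rule scale[of "- 1 / p'" r])
        have "r ^ 4 = s\<^sup>2" unfolding r(1)[symmetric] by simp
        hence "r ^ (i + j + k + 1) = s\<^sup>2" by (simp add: 1 eval_nat_numeral)
        hence "- 1 / p' * p * r ^ (i + j + k + 1) = - (p * s\<^sup>2) / p'" by simp
        thus "- 1 / p' * p * r ^ (i + j + k + 1) = 1" unfolding ps using nz by simp
      qed (use nz r 1 in auto)
      thus ?thesis unfolding eq_bin 1 using iff[of 1 1 1 1 "- 1"] by simp
    next
      case 2
      thus ?thesis unfolding eq_bin using iff[of 0 1 1 "- 1" 1] odd by simp
    next
      case 3
      thus ?thesis unfolding eq_bin using iff[of 1 0 1 "- 1" 1] odd by simp
    next
      case 4
      thus ?thesis unfolding eq_bin using iff[of 1 0 1 "- 1" 1] odd by simp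
    next
      case 5
      have "moebius_transformed E (bin 1 (- 1) i j k)"
      proof (rule scale[of "s / p" "1 / s"])
        show "s / p * p' * (1 / s) ^ ((1 - i) + (1 - j) + (1 - k)) = - 1"
        proof -
          have "s / p * p' * (1 / s) ^ ((1 - i) + (1 - j) + (1 - k)) = p' / (p * s\<^sup>2)"
            unfolding 5 using s by (simp add: eval_nat_numeral)
          thus ?thesis unfolding ps using nz by simp
        qed
      qed (use nz s 5 in auto)
      thus ?thesis unfolding eq_bin 5 using iff[of 0 0 0 1 "- 1"] by simp
    next
      case 6
      hence "equivalent E (eq_e (- p' / p))" unfolding eq_bin using iff[of 0 0 1] pair by simp
      moreover have "- p' / p \<noteq> 0" using nz by simp
      ultimately show ?thesis by blast
    next
      case 7
      hence "equivalent E (eq_e (- p' / p))" unfolding eq_bin using iff[of 0 0 1] pair by simp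
      moreover have "- p' / p \<noteq> 0" using nz by simp
      ultimately show ?thesis by blast
    next
      case 8
      hence "equivalent E (eq_f (- p' / p))" unfolding eq_bin using iff[of 1 0 0] pair by simp
      moreover have "- p' / p \<noteq> 0" using nz by simp
      ultimately show ?thesis by blast
    qed
  }
  have wit: ?L if "equivalent E (bin p p' i j k)" "p \<noteq> 0" "p' \<noteq> 0" "i \<le> 1" "j \<le> 1" "k \<le> 1" for p p' i j k
    using iff[OF that(4-6), of p p'] that by blast
  assume ?R
  thus ?L unfolding eq_bin by (elim disjE exE conjE) (erule wit; simp)+
qed


section \<open>Logarithmic relations modulo periods and the classification\<close>

lemma Ln_sum_iff:
  assumes "exp s = P / Q" "Q \<noteq> 0"
  shows "P = Q \<longleftrightarrow> (\<exists>z::int. s = 2 * of_real pi * \<i> * of_int z)"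
proof -
  have "P = Q \<longleftrightarrow> exp s = exp 0" using assms by simp
  also have "\<dots> \<longleftrightarrow> (\<exists>z::int. s = 2 * of_real pi * \<i> * of_int z)"
    unfolding exp_eq by (simp add: mult_ac)
  finally show ?thesis .
qed

theorem theorem1:
  shows
   "(\<forall>E. admissible E \<longrightarrow>
       (moebius_linearizable E \<longleftrightarrow>
         (\<exists>\<beta> \<gamma> \<delta> \<epsilon>. \<epsilon> \<in> {0, 1} \<and> \<beta> \<noteq> 0 \<and> \<gamma> \<noteq> 0 \<and> \<delta> \<noteq> 0 \<and> equivalent E (eq_inv \<beta> \<gamma> \<delta> \<epsilon>))))
    \<and>
    (\<forall>\<beta> \<gamma> \<delta> \<epsilon> w00 w10 w01 w11 :: complex.
       \<epsilon> \<in> {0, 1} \<and> \<beta> \<noteq> 0 \<and> \<gamma> \<noteq> 0 \<and> \<delta> \<noteq> 0 \<and>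
       w00 \<noteq> 0 \<and> w10 \<noteq> 0 \<and> w01 \<noteq> 0 \<and> w11 \<noteq> 0 \<longrightarrow>
       (eq_inv \<beta> \<gamma> \<delta> \<epsilon> w00 w10 w01 w11 = 0 \<longleftrightarrow>
          1 / w00 + \<beta> * (1 / w10) + \<gamma> * (1 / w01) + \<delta> * (1 / w11) + \<epsilon> = 0))
    \<and>
    (\<forall>E. admissible E \<longrightarrow>
       (point_linearizable E \<and> \<not> moebius_linearizable E \<longleftrightarrow>
         equivalent E eq_a \<or> equivalent E eq_b \<or> equivalent E eq_c \<or> equivalent E eq_d \<or>
         (\<exists>\<theta>. \<theta> \<noteq> 0 \<and> equivalent E (eq_e \<theta>)) \<or>
         (\<exists>\<theta>. \<theta> \<noteq> 0 \<and> equivalent E (eq_f \<theta>))))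
    \<and>
    (\<forall>w00 w10 w01 w11 :: complex.
       w00 \<noteq> 0 \<and> w10 \<noteq> 0 \<and> w01 \<noteq> 0 \<and> w11 \<noteq> 0 \<longrightarrow>
       (eq_a w00 w10 w01 w11 = 0 \<longleftrightarrow>
          (\<exists>z::int. Ln w00 + Ln w10 + Ln w01 + Ln w11 = 2 * of_real pi * \<i> * of_int z)) \<and>
       (eq_b w00 w10 w01 w11 = 0 \<longleftrightarrow>
          (\<exists>z::int. - Ln w00 + Ln w10 + Ln w01 + Ln w11 = 2 * of_real pi * \<i> * of_int z)) \<and>
       (eq_c w00 w10 w01 w11 = 0 \<longleftrightarrow>
          (\<exists>z::int. Ln w00 - Ln w10 + Ln w01 + Ln w11 = 2 * of_real pi * \<i> * of_int z)) \<and>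
       (eq_d w00 w10 w01 w11 = 0 \<longleftrightarrow>
          (\<exists>z::int. - Ln w00 - Ln w10 - Ln w01 + Ln w11 = 2 * of_real pi * \<i> * of_int z)) \<and>
       (\<forall>\<theta>. \<theta> \<noteq> 0 \<longrightarrow>
         (eq_e \<theta> w00 w10 w01 w11 = 0 \<longleftrightarrow>
            (\<exists>z::int. - Ln w00 - Ln w10 + Ln w01 + Ln w11 = Ln \<theta> + 2 * of_real pi * \<i> * of_int z)) \<and>
         (eq_f \<theta> w00 w10 w01 w11 = 0 \<longleftrightarrow>
            (\<exists>z::int. Ln w00 - Ln w10 - Ln w01 + Ln w11 = Ln \<theta> + 2 * of_real pi * \<i> * of_int z))))"
proof (intro conjI allI impI, goal_cases)
  case (1 E)
  thus ?case using moebius_linearizable_iff[of E] unfolding admissible_def by blast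
next
  case (2 \<beta> \<gamma> \<delta> \<epsilon> w00 w10 w01 w11)
  hence "eq_inv \<beta> \<gamma> \<delta> \<epsilon> w00 w10 w01 w11 =
      w00 * w10 * w01 * w11 * (1 / w00 + \<beta> * (1 / w10) + \<gamma> * (1 / w01) + \<delta> * (1 / w11) + \<epsilon>)"
    by (simp add: eq_inv_def field_simps)
  thus ?case using 2 by simp
next
  case (3 E)
  hence ml: "multilinear E" unfolding admissible_def by blast
  \<comment> \<open>A linearizable equation without Moebius linearization leads to a binomial;
    conversely a binomial has a logarithmic linearization, and its discriminant excludes a Moebius
    one.\<close>
  show ?case
    unfolding moebius_transformed_bin_iff[OF ml, symmetric]
    using linearizes_imp_bin[OF ml] bin_imp_point_linearizable[OF ml]
      bin_imp_not_moebius_linearizable[OF ml]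
    unfolding point_linearizable_def by metis
next
  case (4 w00 w10 w01 w11)
  thus ?case using Ln_sum_iff[of "Ln w00 + Ln w10 + Ln w01 + Ln w11" "w00 * w10 * w01 * w11" 1]
    by (simp add: eq_a_def exp_add)
next
  case (5 w00 w10 w01 w11)
  have e: "exp (- Ln w00 + Ln w10 + Ln w01 + Ln w11) = (w10 * w01 * w11) / (w00)"
    using 5 by (simp add: exp_add exp_diff exp_minus field_simps)
  have "eq_b w00 w10 w01 w11 = 0 \<longleftrightarrow> w10 * w01 * w11 = w00" by (auto simp: eq_b_def)
  thus ?case using Ln_sum_iff[OF e] 5 by simp
next
  case (6 w00 w10 w01 w11)
  have e: "exp (Ln w00 - Ln w10 + Ln w01 + Ln w11) = (w00 * w01 * w11) / (w10)"
    using 6 by (simp add: exp_add exp_diff exp_minus field_simps)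
  have "eq_c w00 w10 w01 w11 = 0 \<longleftrightarrow> w00 * w01 * w11 = w10" by (auto simp: eq_c_def)
  thus ?case using Ln_sum_iff[OF e] 6 by simp
next
  case (7 w00 w10 w01 w11)
  have e: "exp (- Ln w00 - Ln w10 - Ln w01 + Ln w11) = (w11) / (w00 * w10 * w01)"
    using 7 by (simp add: exp_add exp_diff exp_minus field_simps)
  have "eq_d w00 w10 w01 w11 = 0 \<longleftrightarrow> w11 = w00 * w10 * w01" by (auto simp: eq_d_def)
  thus ?case using Ln_sum_iff[OF e] 7 by simp
next
  case (8 w00 w10 w01 w11 \<theta>)
  \<comment> \<open>Moving \<open>Ln \<theta>\<close> to the left reduces the claim to a sum that is
    a period of \<open>exp\<close>.\<close>
  have e: "exp (- Ln w00 - Ln w10 + Ln w01 + Ln w11 - Ln \<theta>) = (w01 * w11) / (\<theta> * w00 * w10)"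
    using 8 by (simp add: exp_add exp_diff exp_minus field_simps)
  show ?case using Ln_sum_iff[OF e] 8 by (simp add: eq_e_def diff_eq_eq add.commute)
next
  case (9 w00 w10 w01 w11 \<theta>)
  have e: "exp (Ln w00 - Ln w10 - Ln w01 + Ln w11 - Ln \<theta>) = (w00 * w11) / (\<theta> * w10 * w01)"
    using 9 by (simp add: exp_add exp_diff exp_minus field_simps)
  show ?case using Ln_sum_iff[OF e] 9 by (simp add: eq_f_def diff_eq_eq add.commute)
qed

end
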